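(* Let $G$ be a six-dimensional almost abelian Lie group endowed with a left-invariant complex structure $J$ and a left-invariant nowhere vanishing closed $(3,0)$-form $\Psi$, and let $\omega_0$ be (the fundamental form of) a left-invariant balanced Hermitian metric on $(G,J)$. Then, for all $\tau,\alpha'\in\mathbb{R}$, the left-invariant solution $\omega(t)$ of the anomaly flow $$\tfrac{\partial}{\partial t}\big(\lVert\Psi\rVert_{\omega(t)}\,\omega(t)^2\big)=i\partial\overline\partial\omega(t)-\frac{\alpha'}{4}\operatorname{tr}(R^\tau_t\wedge R^\tau_t),\qquad \omega(0)=\omega_0,$$ is balanced for all $t$ for which it is defined; that is, the anomaly flow preserves the balanced condition in the left-invariant case.
   Context: A Lie group is almost abelian if its Lie algebra contains an abelian ideal of codimension one. A Hermitian metric $g$ on $(G,J)$, with fundamental form $\omega=g(J\cdot,\cdot)$ (identified with $g$), is balanced if $d\omega^2=0$ (complex dimension 3). The norm of $\Psi$ is defined by $i\Psi\wedge\overline\Psi=\lVert\Psi\rVert_\omega^2\,\omega^3$. For $\tau\in\mathbb{R}$, $R^\tau_t$ is the curvature of the canonical Hermitian (Gauduchon) connection $\nabla^\tau$ of $\omega(t)$, where $g(\nabla^\tau_XY,Z)=g(\nabla^g_XY,Z)+\frac{1-\tau}{4}T(X,Y,Z)+\frac{1+\tau}{4}C(X,Y,Z)$, $\nabla^g$ is the Levi-Civita connection, $T(X,Y,Z)=d\omega(JX,JY,JZ)$, $C(X,Y,Z)=-d\omega(JX,Y,Z)$. The curvature 2-forms $\Omega^i_j$ with respect to a $g$-orthonormal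 frame $\{e_i\}$ are given by $R^\tau(X,Y)=\Omega^i_j(X,Y)\,e^j\otimes e_i$, and $\operatorname{tr}(R^\tau\wedge R^\tau)=\sum_{i<j}\Omega^i_j\wedge\Omega^i_j$. *)

theory Defs
  imports "HOL-Analysis.Analysis"
begin

section \<open>Lie groups\<close>

text \<open>\<open>C\<^sup>\<infinity>\<close> maps on an open subset \<open>S\<close> of a Euclidean space: all iterated directional
  derivatives exist and are continuous.\<close>

primrec times_differentiable_on ::
    "'a::euclidean_space set \<Rightarrow> ('a \<Rightarrow> 'b::euclidean_space) \<Rightarrow> nat \<Rightarrow> bool" where
  "times_differentiable_on S f 0 \<longleftrightarrow> continuous_on S f"
| "times_differentiable_on S f (Suc n) \<longleftrightarrow>
     (\<forall>x\<in>S. f differentiable (at x)) \<and>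
     (\<forall>v. times_differentiable_on S (\<lambda>x. frechet_derivative f (at x) v) n)"

definition smooth_on :: "'a::euclidean_space set \<Rightarrow> ('a \<Rightarrow> 'b::euclidean_space) \<Rightarrow> bool" where
  "smooth_on S f \<longleftrightarrow> (\<forall>n. times_differentiable_on S f n)"

text \<open>A chart is a pair \<open>(U, \<phi>)\<close>; only the values of \<open>\<phi>\<close> on \<open>U\<close> are meaningful.\<close>

type_synonym ('g, 'e) atlas = "('g set \<times> ('g \<Rightarrow> 'e)) set"

definition smooth_atlas :: "('g::topological_space, 'e::euclidean_space) atlas \<Rightarrow> bool" where
  "smooth_atlas A \<longleftrightarrow>
     (\<Union>(U, \<phi>)\<in>A. U) = UNIV \<and>
     (\<forall>(U, \<phi>)\<in>A. open U \<and> open (\<phi> ` U) \<and> homeomorphism U (\<phi> ` U) \<phi> (inv_into U \<phi>)) \<and>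
     (\<forall>(U, \<phi>)\<in>A. \<forall>(V, \<psi>)\<in>A. smooth_on (\<phi> ` (U \<inter> V)) (\<psi> \<circ> inv_into U \<phi>))"

definition prod_atlas ::
    "('g, 'e) atlas \<Rightarrow> ('h, 'f) atlas \<Rightarrow> ('g \<times> 'h, 'e \<times> 'f) atlas" where
  "prod_atlas A B = {(U \<times> V, map_prod \<phi> \<psi>) |U \<phi> V \<psi>. (U, \<phi>) \<in> A \<and> (V, \<psi>) \<in> B}"

definition smooth_map ::
    "('g::topological_space, 'e::euclidean_space) atlas \<Rightarrow>
     ('h::topological_space, 'f::euclidean_space) atlas \<Rightarrow> ('g \<Rightarrow> 'h) \<Rightarrow> bool" where
  "smooth_map A B f \<longleftrightarrow> continuous_on UNIV f \<and>
     (\<forall>(U, \<phi>)\<in>A. \<forall>(V, \<psi>)\<in>B. smooth_on (\<phi> ` (U \<inter> f -` V)) (\<psi> \<circ> f \<circ> inv_into U \<phi>))"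

text \<open>A Lie group of dimension \<open>DIM('e)\<close> whose underlying manifold is the whole type \<open>'g\<close>.\<close>

definition lie_group ::
    "('g::{t2_space, second_countable_topology}, 'e::euclidean_space) atlas \<Rightarrow>
     ('g \<Rightarrow> 'g \<Rightarrow> 'g) \<Rightarrow> 'g \<Rightarrow> ('g \<Rightarrow> 'g) \<Rightarrow> bool" where
  "lie_group A mul one ivs \<longleftrightarrow>
     smooth_atlas A \<and> group mul one ivs \<and>
     smooth_map (prod_atlas A A) A (\<lambda>(x, y). mul x y) \<and> smooth_map A A ivs"

text \<open>A chart \<open>(U, \<phi>)\<close> around the identity identifies the Lie algebra \<open>T\<^sub>1G\<close> with \<open>'e\<close> by means of the
  differential of \<open>\<phi>\<close> at the identity. In this chart the left-invariant vector field extending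
  \<open>u\<close> takes at the group element with coordinates \<open>x\<close> the value \<open>dL(u)\<close>, where \<open>L\<close> is
  the left translation by that element; the Lie bracket is the value at the identity of the
  commutator \<open>[X, Y] = DY(X) - DX(Y)\<close> of left-invariant vector fields.\<close>

definition left_invariant_field ::
    "('g \<Rightarrow> 'g \<Rightarrow> 'g) \<Rightarrow> 'g \<Rightarrow> 'g set \<Rightarrow> ('g \<Rightarrow> 'e::euclidean_space) \<Rightarrow> 'e \<Rightarrow> 'e \<Rightarrow> 'e" where
  "left_invariant_field mul one U \<phi> u x =
     frechet_derivative (\<lambda>y. \<phi> (mul (inv_into U \<phi> x) (inv_into U \<phi> y))) (at (\<phi> one)) u"

definition vector_field_bracket ::
    "('e \<Rightarrow> 'e) \<Rightarrow> ('e \<Rightarrow> 'e) \<Rightarrow> 'e \<Rightarrow> 'e::euclidean_space" where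
  "vector_field_bracket X Y x =
     frechet_derivative Y (at x) (X x) - frechet_derivative X (at x) (Y x)"

definition lie_bracket ::
    "('g \<Rightarrow> 'g \<Rightarrow> 'g) \<Rightarrow> 'g \<Rightarrow> 'g set \<Rightarrow> ('g \<Rightarrow> 'e::euclidean_space) \<Rightarrow> 'e \<Rightarrow> 'e \<Rightarrow> 'e" where
  "lie_bracket mul one U \<phi> u v =
     vector_field_bracket (left_invariant_field mul one U \<phi> u)
       (left_invariant_field mul one U \<phi> v) (\<phi> one)"

definition almost_abelian :: "('e::euclidean_space \<Rightarrow> 'e \<Rightarrow> 'e) \<Rightarrow> bool" where
  "almost_abelian br \<longleftrightarrow> (\<exists>\<hh>. subspace \<hh> \<and> dim \<hh> + 1 = DIM('e) \<and>
     (\<forall>x. \<forall>y\<in>\<hh>. br x y \<in> \<hh>) \<and> (\<forall>x\<in>\<hh>. \<forall>y\<in>\<hh>. br x y = 0))"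


section \<open>Left-invariant forms\<close>

text \<open>From here on \<open>br\<close> is the bracket of the Lie algebra on \<open>'e\<close>, and left-invariant tensor fields
  are represented by their (constant) values on left-invariant vector fields, that is, by
  tensors on the Lie algebra. A \<open>k\<close>-form is a function of the list of its \<open>k\<close> arguments, equal to
  \<open>0\<close> on lists of any other length, so that the degree need not be passed to the operations below.\<close>

type_synonym ('e, 'b) form = "'e list \<Rightarrow> 'b"

definition is_form :: "nat \<Rightarrow> ('e::real_vector, 'b::real_vector) form \<Rightarrow> bool" where
  "is_form k \<alpha> \<longleftrightarrow>
     (\<forall>vs. length vs \<noteq> k \<longrightarrow> \<alpha> vs = 0) \<and>
     (\<forall>vs i. length vs = k \<and> i < k \<longrightarrow> linear (\<lambda>x. \<alpha> (vs[i := x]))) \<and>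
     (\<forall>vs i j. length vs = k \<and> i < j \<and> j < k \<and> vs ! i = vs ! j \<longrightarrow> \<alpha> vs = 0)"

text \<open>Sum over shuffles: \<open>S\<close> is the set of positions given to \<open>\<alpha>\<close>; no factorials are involved.\<close>

definition wedge :: "('e, 'b) form \<Rightarrow> ('e, 'b) form \<Rightarrow> ('e, 'b::comm_ring_1) form"
    (infixr "\<and>\<^sub>w" 75) where
  "(\<alpha> \<and>\<^sub>w \<beta>) vs = (\<Sum>S\<in>Pow {..<length vs}.
     (-1) ^ card {(i, j). i \<in> S \<and> j \<notin> S \<and> j < i} * \<alpha> (nths vs S) * \<beta> (nths vs (- S)))"

text \<open>The exterior derivative
  \<open>d\<alpha>(X\<^sub>0, \<dots>, X\<^sub>k) = \<Sum>\<^sub>i (-1)\<^sup>i X\<^sub>i(\<alpha>(\<dots>)) + \<Sum>\<^sub>i\<^sub><\<^sub>j (-1)\<^sup>i\<^sup>+\<^sup>j \<alpha>([X\<^sub>i, X\<^sub>j], \<dots>)\<close>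
  on left-invariant fields, where the functions \<open>\<alpha>(\<dots>)\<close> in the first sum are constant.\<close>

definition ext_d :: "('e \<Rightarrow> 'e \<Rightarrow> 'e) \<Rightarrow> ('e, 'b) form \<Rightarrow> ('e, 'b::comm_ring_1) form" where
  "ext_d br \<alpha> vs = (\<Sum>j<length vs. \<Sum>i<j.
     (-1) ^ (i + j) * \<alpha> (br (vs ! i) (vs ! j) # nths vs (- {i, j})))"


section \<open>Complex structures and types of forms\<close>

definition complex_structure ::
    "('e::real_vector \<Rightarrow> 'e \<Rightarrow> 'e) \<Rightarrow> ('e \<Rightarrow> 'e) \<Rightarrow> bool" where
  "complex_structure br J \<longleftrightarrow> linear J \<and> (\<forall>x. J (J x) = - x) \<and>
     (\<forall>x y. br (J x) (J y) - J (br (J x) y) - J (br x (J y)) - br x y = 0)"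

text \<open>Complex-multilinear extension to the complexification; \<open>(u, v)\<close> stands for \<open>u + \<i>v\<close>.\<close>

fun complex_ext :: "('e, complex) form \<Rightarrow> ('e \<times> 'e) list \<Rightarrow> complex" where
  "complex_ext \<alpha> [] = \<alpha> []"
| "complex_ext \<alpha> ((u, v) # ws) =
     complex_ext (\<lambda>xs. \<alpha> (u # xs)) ws + \<i> * complex_ext (\<lambda>xs. \<alpha> (v # xs)) ws"

text \<open>\<open>x = x\<^sup>1\<^sup>,\<^sup>0 + x\<^sup>0\<^sup>,\<^sup>1\<close>, where \<open>x\<^sup>1\<^sup>,\<^sup>0 = (x - \<i>Jx)/2\<close> and \<open>x\<^sup>0\<^sup>,\<^sup>1 = (x + \<i>Jx)/2\<close>.\<close>

definition vec10 :: "('e::real_vector \<Rightarrow> 'e) \<Rightarrow> 'e \<Rightarrow> 'e \<times> 'e" where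
  "vec10 J x = ((1/2) *\<^sub>R x, - (1/2) *\<^sub>R J x)"

definition vec01 :: "('e::real_vector \<Rightarrow> 'e) \<Rightarrow> 'e \<Rightarrow> 'e \<times> 'e" where
  "vec01 J x = ((1/2) *\<^sub>R x, (1/2) *\<^sub>R J x)"

text \<open>The \<open>(p,q)\<close>-component of a \<open>(p+q)\<close>-form.\<close>

definition type_part ::
    "('e::real_vector \<Rightarrow> 'e) \<Rightarrow> nat \<Rightarrow> nat \<Rightarrow> ('e, complex) form \<Rightarrow> ('e, complex) form" where
  "type_part J p q \<alpha> vs =
     (if length vs = p + q
      then \<Sum>S\<in>{S. S \<subseteq> {..<p + q} \<and> card S = p}.
             complex_ext \<alpha> (map (\<lambda>i. if i \<in> S then vec10 J (vs ! i) else vec01 J (vs ! i)) [0..<p + q])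
      else 0)"

definition is_type_form ::
    "('e::real_vector \<Rightarrow> 'e) \<Rightarrow> nat \<Rightarrow> nat \<Rightarrow> ('e, complex) form \<Rightarrow> bool" where
  "is_type_form J p q \<alpha> \<longleftrightarrow> is_form (p + q) \<alpha> \<and> type_part J p q \<alpha> = \<alpha>"

text \<open>The operators \<open>\<partial>\<close> and \<open>\<partial>\<close>-bar on forms of type \<open>(p,q)\<close>.\<close>

definition del :: "('e::real_vector \<Rightarrow> 'e \<Rightarrow> 'e) \<Rightarrow> ('e \<Rightarrow> 'e) \<Rightarrow> nat \<Rightarrow> nat \<Rightarrow>
    ('e, complex) form \<Rightarrow> ('e, complex) form" where
  "del br J p q \<alpha> = type_part J (p + 1) q (ext_d br \<alpha>)"

definition delbar :: "('e::real_vector \<Rightarrow> 'e \<Rightarrow> 'e) \<Rightarrow> ('e \<Rightarrow> 'e) \<Rightarrow> nat \<Rightarrow> nat \<Rightarrow>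
    ('e, complex) form \<Rightarrow> ('e, complex) form" where
  "delbar br J p q \<alpha> = type_part J p (q + 1) (ext_d br \<alpha>)"


section \<open>Hermitian metrics\<close>

definition riemannian_metric :: "('e::real_vector \<Rightarrow> 'e \<Rightarrow> real) \<Rightarrow> bool" where
  "riemannian_metric g \<longleftrightarrow>
     bilinear g \<and> (\<forall>x y. g x y = g y x) \<and> (\<forall>x. x \<noteq> 0 \<longrightarrow> g x x > 0)"

definition hermitian_metric :: "('e::real_vector \<Rightarrow> 'e) \<Rightarrow> ('e \<Rightarrow> 'e \<Rightarrow> real) \<Rightarrow> bool" where
  "hermitian_metric J g \<longleftrightarrow> riemannian_metric g \<and> (\<forall>x y. g (J x) (J y) = g x y)"

definition fundamental_form :: "('e \<Rightarrow> 'e) \<Rightarrow> ('e \<Rightarrow> 'e \<Rightarrow> real) \<Rightarrow> ('e, real) form" where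
  "fundamental_form J g vs = (case vs of [x, y] \<Rightarrow> g (J x) y | _ \<Rightarrow> 0)"

definition balanced ::
    "('e \<Rightarrow> 'e \<Rightarrow> 'e) \<Rightarrow> ('e \<Rightarrow> 'e) \<Rightarrow> ('e \<Rightarrow> 'e \<Rightarrow> real) \<Rightarrow> bool" where
  "balanced br J g \<longleftrightarrow>
     (\<forall>vs. ext_d br (fundamental_form J g \<and>\<^sub>w fundamental_form J g) vs = 0)"

definition norm_wrt :: "('e, complex) form \<Rightarrow> ('e, real) form \<Rightarrow> real" where
  "norm_wrt \<Psi> \<omega> = (THE c. c \<ge> 0 \<and>
     (\<forall>vs. \<i> * (\<Psi> \<and>\<^sub>w (\<lambda>xs. cnj (\<Psi> xs))) vs = complex_of_real (c\<^sup>2 * (\<omega> \<and>\<^sub>w \<omega> \<and>\<^sub>w \<omega>) vs)))"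


section \<open>Gauduchon connections and curvature\<close>

text \<open>Left-invariant connections are given by bilinear maps \<open>(X, Y) \<mapsto> \<nabla>\<^sub>X Y\<close> on the Lie algebra.
  As \<open>g(Y, Z)\<close> is constant for left-invariant \<open>Y\<close> and \<open>Z\<close>, metric compatibility reads
  \<open>g(\<nabla>\<^sub>X Y, Z) + g(Y, \<nabla>\<^sub>X Z) = 0\<close>.\<close>

definition levi_civita ::
    "('e::real_vector \<Rightarrow> 'e \<Rightarrow> 'e) \<Rightarrow> ('e \<Rightarrow> 'e \<Rightarrow> real) \<Rightarrow> 'e \<Rightarrow> 'e \<Rightarrow> 'e" where
  "levi_civita br g = (THE D. bilinear D \<and>
     (\<forall>X Y. D X Y - D Y X = br X Y) \<and>
     (\<forall>X Y Z. g (D X Y) Z + g Y (D X Z) = 0))"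

definition gauduchon :: "('e::real_vector \<Rightarrow> 'e \<Rightarrow> 'e) \<Rightarrow> ('e \<Rightarrow> 'e) \<Rightarrow> ('e \<Rightarrow> 'e \<Rightarrow> real) \<Rightarrow>
    real \<Rightarrow> 'e \<Rightarrow> 'e \<Rightarrow> 'e" where
  "gauduchon br J g \<tau> X Y = (let d\<omega> = ext_d br (fundamental_form J g) in
     THE W. \<forall>Z. g W Z = g (levi_civita br g X Y) Z
       + (1 - \<tau>) / 4 * d\<omega> [J X, J Y, J Z] + (1 + \<tau>) / 4 * (- d\<omega> [J X, Y, Z]))"

definition curvature ::
    "('e::real_vector \<Rightarrow> 'e \<Rightarrow> 'e) \<Rightarrow> ('e \<Rightarrow> 'e \<Rightarrow> 'e) \<Rightarrow> 'e \<Rightarrow> 'e \<Rightarrow> 'e \<Rightarrow> 'e" where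
  "curvature br D X Y Z = D X (D Y Z) - D Y (D X Z) - D (br X Y) Z"

text \<open>\<open>e 0, \<dots>, e (DIM('e) - 1)\<close> is the frame.\<close>

definition orthonormal_frame ::
    "('e::euclidean_space \<Rightarrow> 'e \<Rightarrow> real) \<Rightarrow> (nat \<Rightarrow> 'e) \<Rightarrow> bool" where
  "orthonormal_frame g e \<longleftrightarrow>
     (\<forall>i<DIM('e). \<forall>j<DIM('e). g (e i) (e j) = (if i = j then 1 else 0))"

definition curvature_form :: "('e::real_vector \<Rightarrow> 'e \<Rightarrow> 'e) \<Rightarrow> ('e \<Rightarrow> 'e \<Rightarrow> real) \<Rightarrow>
    ('e \<Rightarrow> 'e \<Rightarrow> 'e) \<Rightarrow> (nat \<Rightarrow> 'e) \<Rightarrow> nat \<Rightarrow> nat \<Rightarrow> ('e, real) form" where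
  "curvature_form br g D e i j vs =
     (case vs of [X, Y] \<Rightarrow> g (curvature br D X Y (e j)) (e i) | _ \<Rightarrow> 0)"

definition trace_curvature_sq :: "('e::euclidean_space \<Rightarrow> 'e \<Rightarrow> 'e) \<Rightarrow> ('e \<Rightarrow> 'e \<Rightarrow> real) \<Rightarrow>
    ('e \<Rightarrow> 'e \<Rightarrow> 'e) \<Rightarrow> (nat \<Rightarrow> 'e) \<Rightarrow> ('e, real) form" where
  "trace_curvature_sq br g D e vs = (\<Sum>j<DIM('e). \<Sum>i<j.
     (curvature_form br g D e i j \<and>\<^sub>w curvature_form br g D e i j) vs)"


section \<open>The anomaly flow\<close>

text \<open>Left-invariant solutions defined on the interval \<open>I\<close> containing \<open>0\<close>, as curves of metrics
  \<open>g t\<close> with fundamental forms \<open>\<omega>(t)\<close>. The trace of the squared curvature does not depend on the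
  orthonormal frame \<open>e\<close> in which it is written.\<close>

definition anomaly_flow_solution :: "('e::euclidean_space \<Rightarrow> 'e \<Rightarrow> 'e) \<Rightarrow> ('e \<Rightarrow> 'e) \<Rightarrow>
    ('e, complex) form \<Rightarrow> real \<Rightarrow> real \<Rightarrow> ('e \<Rightarrow> 'e \<Rightarrow> real) \<Rightarrow> real set \<Rightarrow>
    (real \<Rightarrow> 'e \<Rightarrow> 'e \<Rightarrow> real) \<Rightarrow> bool" where
  "anomaly_flow_solution br J \<Psi> \<tau> \<alpha>' g\<^sub>0 I g \<longleftrightarrow>
     is_interval I \<and> 0 \<in> I \<and> g 0 = g\<^sub>0 \<and>
     (let \<omega> = (\<lambda>t. fundamental_form J (g t)) in
      \<forall>t\<in>I. hermitian_metric J (g t) \<and>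
        (\<exists>e. orthonormal_frame (g t) e \<and>
          (\<forall>vs. ((\<lambda>s. complex_of_real (norm_wrt \<Psi> (\<omega> s) * (\<omega> s \<and>\<^sub>w \<omega> s) vs)) has_vector_derivative
              \<i> * del br J 1 2 (delbar br J 1 1 (\<lambda>xs. complex_of_real (\<omega> t xs))) vs
              - complex_of_real (\<alpha>' / 4 *
                  trace_curvature_sq br (g t) (gauduchon br J (g t) \<tau>) e vs)) (at t within I))))"

end

theory Submission
  imports Defs
begin

text \<open>Both terms on the right-hand side of the flow are closed: \<open>d\<close> annihilates \<open>\<partial>\<close>\<open>\<partial>\<close>-bar of a form, and
  \<open>d tr(R \<and> R) = 0\<close> by the Bianchi identity, because every Gauduchon connection is metric. Hence
  \<open>d(\<parallel>\<Psi>\<parallel> \<omega>\<^sup>2)\<close> is constant in time, and it vanishes at time \<open>0\<close>. As \<open>\<parallel>\<Psi>\<parallel>\<close> is a positive constant on the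
  group, \<open>d\<omega>\<^sup>2 = 0\<close> throughout. The abelian ideal of codimension one enters only through the Jacobi
  identity, which it makes immediate.\<close>

section \<open>The Lie algebra of a Lie group\<close>

text \<open>The flow prescribes the derivative of the product of
  \<open>norm_wrt \<Psi> \<omega>\<close> and \<open>\<omega> \<and>\<^sub>w \<omega>\<close>, and d
  is linear and does not depend on time, so no evolution equation for the metric itself has to be
  derived. One obstacle is that \<open>del\<close> and \<open>delbar\<close> are d followed by a
  projection to a type: d d = 0 yields closedness of the first source term only after the projection
  to type (2,2) is seen to act as the identity. Types are handled through the derivation that
  \<open>J\<close> induces on forms, without building the bigraded algebra. Another obstacle is that
  \<open>levi_civita\<close>, \<open>gauduchon\<close> and \<open>norm_wrt\<close> are definite
  descriptions, usable only after existence and uniqueness; for the norm this takes a unitary frame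
  and a comparison of top-degree forms, which is where dimension six enters. Closedness is in the
  end a finite identity between values on explicit lists of arguments.\<close>

lemma left_invariant_field_eq:
  fixes A :: "('g::{t2_space, second_countable_topology}, 'e::euclidean_space) atlas"
  assumes "lie_group A mul one ivs" "(U, \<phi>) \<in> A" "one \<in> U"
  shows "\<exists>F :: 'e \<times> 'e \<Rightarrow> 'e. \<forall>x\<in>\<phi> ` U. F differentiable (at (x, \<phi> one)) \<and>
      (\<forall>u. left_invariant_field mul one U \<phi> u x = frechet_derivative F (at (x, \<phi> one)) (0, u)) \<and>
      (\<forall>v. (\<lambda>p. frechet_derivative F (at p) v) differentiable (at (x, \<phi> one)))"
proof -
  let ?m = "\<lambda>(x, y). mul x y"
  \<comment> \<open>\<open>F\<close> is the multiplication read in the chart on both factors. The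
    left-invariant field is its partial derivative in the second variable at
    \<open>(x, \<phi> one)\<close>, so two orders of smoothness of \<open>F\<close> give one order
    for the field. At these points the product lies in \<open>U\<close>, so they belong to the
    domain \<open>\<Omega>\<close>.\<close>
  define F where "F = \<phi> \<circ> ?m \<circ> inv_into (U \<times> U) (map_prod \<phi> \<phi>)"
  define \<Omega> where "\<Omega> = map_prod \<phi> \<phi> ` (U \<times> U \<inter> ?m -` U)"
  have "smooth_atlas A" and gr: "group mul one ivs" and sm: "smooth_map (prod_atlas A A) A ?m"
    using assms(1) by (auto simp: lie_group_def)
  then have opn: "open (\<phi> ` U)" and hom: "homeomorphism U (\<phi> ` U) \<phi> (inv_into U \<phi>)"
    using assms(2) by (auto simp: smooth_atlas_def)
  have inj: "inj_on \<phi> U"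
    using hom by (metis homeomorphism_def inj_on_inverseI)
  interpret G: group mul one ivs by (rule gr)
  have "(U \<times> U, map_prod \<phi> \<phi>) \<in> prod_atlas A A"
    using assms(2) by (auto simp: prod_atlas_def)
  then have "smooth_on \<Omega> F"
    using sm assms(2) unfolding smooth_map_def F_def \<Omega>_def by blast
  then have "times_differentiable_on \<Omega> F (Suc (Suc 0))"
    unfolding smooth_on_def by blast
  then have 1: "F differentiable (at p)" and 2: "(\<lambda>p. frechet_derivative F (at p) v) differentiable (at p)"
    if "p \<in> \<Omega>" for p v
    using that unfolding times_differentiable_on.simps by blast+
  have \<Omega>: "(x, \<phi> one) \<in> \<Omega>" if x: "x \<in> \<phi> ` U" for x
  proof -
    obtain a where "a \<in> U" "x = \<phi> a" using x by auto
    moreover have "mul a one = a"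
      by (rule G.right_neutral)
    ultimately have "(x, \<phi> one) = map_prod \<phi> \<phi> (a, one)" "(a, one) \<in> U \<times> U \<inter> ?m -` U"
      using assms(3) by auto
    then show ?thesis unfolding \<Omega>_def by (rule image_eqI)
  qed
  have F: "F (x, y) = \<phi> (mul (inv_into U \<phi> x) (inv_into U \<phi> y))" if xy: "x \<in> \<phi> ` U" "y \<in> \<phi> ` U" for x y
  proof -
    obtain a b where ab: "a \<in> U" "b \<in> U" "x = \<phi> a" "y = \<phi> b" using xy by auto
    have "inv_into (U \<times> U) (map_prod \<phi> \<phi>) (map_prod \<phi> \<phi> (a, b)) = (a, b)"
      using ab inj by (intro inv_into_f_f map_prod_inj_on) auto
    then show ?thesis using ab inj by (simp add: F_def)
  qed
  have "left_invariant_field mul one U \<phi> u x = frechet_derivative F (at (x, \<phi> one)) (0, u)"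
    if x: "x \<in> \<phi> ` U" for x u
  proof -
    have "((\<lambda>y. (x, y)) has_derivative (\<lambda>h. (0, h))) (at (\<phi> one))"
      by (auto intro!: derivative_eq_intros)
    moreover have "(F has_derivative frechet_derivative F (at (x, \<phi> one))) (at (x, \<phi> one))"
      using 1[OF \<Omega>[OF x]] frechet_derivative_works by blast
    ultimately have "((\<lambda>y. F (x, y)) has_derivative (\<lambda>h. frechet_derivative F (at (x, \<phi> one)) (0, h)))
        (at (\<phi> one))"
      by (rule has_derivative_compose)
    then have "((\<lambda>y. \<phi> (mul (inv_into U \<phi> x) (inv_into U \<phi> y))) has_derivative
        (\<lambda>h. frechet_derivative F (at (x, \<phi> one)) (0, h))) (at (\<phi> one))"
      by (rule has_derivative_transform_within_open[OF _ opn]) (use assms(3) F x in auto)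
    from fun_cong[OF frechet_derivative_at[OF this], of u] show ?thesis
      by (simp add: left_invariant_field_def)
  qed
  with 1 2 \<Omega> show ?thesis by blast
qed

lemma
  fixes A :: "('g::{t2_space, second_countable_topology}, 'e::euclidean_space) atlas"
  assumes "lie_group A mul one ivs" "(U, \<phi>) \<in> A" "one \<in> U"
  shows linear_left_invariant_field:
      "x \<in> \<phi> ` U \<Longrightarrow> linear (\<lambda>u. left_invariant_field mul one U \<phi> u x)"
    and differentiable_left_invariant_field:
      "left_invariant_field mul one U \<phi> u differentiable (at (\<phi> one))"
proof -
  obtain F :: "'e \<times> 'e \<Rightarrow> 'e"
    where "\<forall>x\<in>\<phi> ` U. F differentiable (at (x, \<phi> one)) \<and>
      (\<forall>u. left_invariant_field mul one U \<phi> u x = frechet_derivative F (at (x, \<phi> one)) (0, u)) \<and>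
      (\<forall>v. (\<lambda>p. frechet_derivative F (at p) v) differentiable (at (x, \<phi> one)))"
    using left_invariant_field_eq[OF assms] by blast
  then have 1: "F differentiable (at (x, \<phi> one))"
      and 2: "left_invariant_field mul one U \<phi> u x = frechet_derivative F (at (x, \<phi> one)) (0, u)"
      and 3: "(\<lambda>p. frechet_derivative F (at p) v) differentiable (at (x, \<phi> one))"
    if "x \<in> \<phi> ` U" for x u v
    using that by blast+
  show "linear (\<lambda>u. left_invariant_field mul one U \<phi> u x)" if "x \<in> \<phi> ` U"
  proof -
    have "linear (frechet_derivative F (at (x, \<phi> one)))"
      using 1[OF that] linear_frechet_derivative by blast
    moreover have "linear (\<lambda>u. (0::'e, u::'e))" by (auto intro!: linearI)
    ultimately have "linear (frechet_derivative F (at (x, \<phi> one)) \<circ> (\<lambda>u. (0, u)))"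
      by (rule linear_compose[rotated])
    then show ?thesis by (simp add: 2[OF that] o_def)
  qed
  have p0: "\<phi> one \<in> \<phi> ` U" using assms(3) by auto
  have opn: "open (\<phi> ` U)"
    using assms(1,2) by (auto simp: lie_group_def smooth_atlas_def)
  have "(\<lambda>x. frechet_derivative F (at (x, \<phi> one)) (0, u)) differentiable (at (\<phi> one))"
  proof -
    have "(\<lambda>x. (x, \<phi> one)) differentiable (at (\<phi> one))"
      unfolding differentiable_def by (auto intro!: derivative_eq_intros exI)
    then have "((\<lambda>p. frechet_derivative F (at p) (0, u)) \<circ> (\<lambda>x. (x, \<phi> one))) differentiable (at (\<phi> one))"
      by (rule differentiable_chain_at) (rule 3[OF p0])
    then show ?thesis by (simp add: o_def)
  qed
  then obtain D where "((\<lambda>x. frechet_derivative F (at (x, \<phi> one)) (0, u)) has_derivative D) (at (\<phi> one))"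
    unfolding differentiable_def by blast
  then have "(left_invariant_field mul one U \<phi> u has_derivative D) (at (\<phi> one))"
    by (rule has_derivative_transform_within_open[OF _ opn p0]) (simp add: 2)
  then show "left_invariant_field mul one U \<phi> u differentiable (at (\<phi> one))"
    unfolding differentiable_def by blast
qed

lemma lie_bracket_self: "lie_bracket mul one U \<phi> u u = 0"
  by (simp add: lie_bracket_def vector_field_bracket_def)

text \<open>On the whole chart a left-invariant field depends linearly on its value at the identity.
  Since the chart image is open, the derivatives of the fields depend linearly on it as
  well.\<close>

lemma bilinear_lie_bracket:
  fixes A :: "('g::{t2_space, second_countable_topology}, 'e::euclidean_space) atlas"
  assumes "lie_group A mul one ivs" "(U, \<phi>) \<in> A" "one \<in> U"
  shows "bilinear (lie_bracket mul one U \<phi>)"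
proof -
  let ?X = "left_invariant_field mul one U \<phi>"
  let ?D = "\<lambda>u. frechet_derivative (?X u) (at (\<phi> one))"
  have p0: "\<phi> one \<in> \<phi> ` U" using assms(3) by auto
  have opn: "open (\<phi> ` U)"
    using assms(1,2) by (auto simp: lie_group_def smooth_atlas_def)
  note lin = linear_left_invariant_field[OF assms]
  have D: "(?X u has_derivative ?D u) (at (\<phi> one))" for u
    using differentiable_left_invariant_field[OF assms] frechet_derivative_works by blast
  have linD: "linear (?D u)" for u
    using D has_derivative_linear by blast
  have add: "?D (u + v) w = ?D u w + ?D v w" for u v w
  proof -
    have "((\<lambda>x. ?X u x + ?X v x) has_derivative (\<lambda>w. ?D u w + ?D v w)) (at (\<phi> one))"
      by (intro has_derivative_add D)
    then have "(?X (u + v) has_derivative (\<lambda>w. ?D u w + ?D v w)) (at (\<phi> one))"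
      by (rule has_derivative_transform_within_open[OF _ opn p0]) (simp add: linear_add[OF lin])
    from fun_cong[OF frechet_derivative_at[OF this], of w] show ?thesis by simp
  qed
  have scale: "?D (c *\<^sub>R u) w = c *\<^sub>R ?D u w" for c u w
  proof -
    have "((\<lambda>x. c *\<^sub>R ?X u x) has_derivative (\<lambda>w. c *\<^sub>R ?D u w)) (at (\<phi> one))"
      by (intro has_derivative_scaleR_right D)
    then have "(?X (c *\<^sub>R u) has_derivative (\<lambda>w. c *\<^sub>R ?D u w)) (at (\<phi> one))"
      by (rule has_derivative_transform_within_open[OF _ opn p0]) (simp add: linear_scale[OF lin])
    from fun_cong[OF frechet_derivative_at[OF this], of w] show ?thesis by simp
  qed
  have br: "lie_bracket mul one U \<phi> = (\<lambda>u v. ?D v (?X u (\<phi> one)) - ?D u (?X v (\<phi> one)))"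
    by (simp add: lie_bracket_def vector_field_bracket_def fun_eq_iff)
  show ?thesis
    unfolding br
    by (auto simp: bilinear_def add scale linear_add[OF lin[OF p0]] linear_scale[OF lin[OF p0]]
        linear_add[OF linD] linear_scale[OF linD] algebra_simps intro!: linearI)
qed

section \<open>Alternating forms on lists\<close>

text \<open>Linearity is asked at every split of a list with no degree fixed, and below alternation
  is asked only for adjacent entries. Both properties survive fixing the head of the list, which
  supports induction on the arguments; the degree is recorded apart, by
  \<open>has_degree\<close>.\<close>

definition multilinear_form :: "('e::real_vector, 'b::real_vector) form \<Rightarrow> bool" where
  "multilinear_form \<alpha> \<longleftrightarrow> (\<forall>us xs. linear (\<lambda>x. \<alpha> (us @ x # xs)))"

definition alternating_form :: "('e::real_vector, 'b::real_vector) form \<Rightarrow> bool" where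
  "alternating_form \<alpha> \<longleftrightarrow> multilinear_form \<alpha> \<and> (\<forall>us x xs. \<alpha> (us @ x # x # xs) = 0)"

definition has_degree :: "nat \<Rightarrow> ('e, 'b::zero) form \<Rightarrow> bool" where
  "has_degree k \<alpha> \<longleftrightarrow> (\<forall>vs. length vs \<noteq> k \<longrightarrow> \<alpha> vs = 0)"

lemma is_form_alternating:
  assumes "is_form k \<alpha>"
  shows "alternating_form \<alpha>" "has_degree k \<alpha>"
proof -
  show deg: "has_degree k \<alpha>"
    using assms by (simp add: is_form_def has_degree_def)
  have "linear (\<lambda>x. \<alpha> (us @ x # xs))" for us xs
  \<comment> \<open>\<open>undefined\<close> is a placeholder for the entry that varies; only the
    length matters.\<close>
  proof (cases "length (us @ undefined # xs) = k")
    case True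
    moreover have "length us < length (us @ undefined # xs)" by simp
    ultimately have "linear (\<lambda>x. \<alpha> ((us @ undefined # xs)[length us := x]))"
      using assms unfolding is_form_def by metis
    then show ?thesis by simp
  next
    case False
    then have "(\<lambda>x. \<alpha> (us @ x # xs)) = (\<lambda>x. 0)"
      using deg by (auto simp: has_degree_def)
    then show ?thesis by (simp add: linear_zero)
  qed
  moreover have "\<alpha> (us @ x # x # xs) = 0" for us x xs
  proof (cases "length (us @ x # x # xs) = k")
    case True
    have "(us @ x # x # xs) ! length us = (us @ x # x # xs) ! Suc (length us)"
      by (simp add: nth_append)
    moreover have "\<forall>i j. i < j \<and> j < k \<and> (us @ x # x # xs) ! i = (us @ x # x # xs) ! j \<longrightarrow>
        \<alpha> (us @ x # x # xs) = 0"
      using assms True by (auto simp: is_form_def)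
    ultimately show ?thesis
      using True by (elim allE[of _ "length us"] allE[of _ "Suc (length us)"]) (auto simp: nth_append)
  next
    case False
    then show ?thesis using deg by (auto simp: has_degree_def)
  qed
  ultimately show "alternating_form \<alpha>"
    by (simp add: alternating_form_def multilinear_form_def)
qed

lemma multilinear_form_add:
  "multilinear_form \<alpha> \<Longrightarrow> \<alpha> (us @ (x + y) # xs) = \<alpha> (us @ x # xs) + \<alpha> (us @ y # xs)"
  unfolding multilinear_form_def using linear_add by blast

lemma multilinear_form_Cons:
  assumes "multilinear_form \<alpha>"
  shows "multilinear_form (\<lambda>xs. \<alpha> (x # xs))"
proof -
  have "linear (\<lambda>y. \<alpha> ((x # us) @ y # xs))" for us xs
    using assms unfolding multilinear_form_def by blast
  then show ?thesis by (simp add: multilinear_form_def)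
qed

lemma alternating_form_Cons:
  assumes "alternating_form \<alpha>"
  shows "alternating_form (\<lambda>xs. \<alpha> (x # xs))"
proof -
  have "\<alpha> ((x # us) @ y # y # xs) = 0" for us y xs
    using assms unfolding alternating_form_def by blast
  then show ?thesis
    using assms by (simp add: alternating_form_def multilinear_form_Cons)
qed

lemma alternating_form_swap:
  assumes "alternating_form \<alpha>"
  shows "\<alpha> (us @ x # y # xs) = - \<alpha> (us @ y # x # xs)"
proof -
  have ml: "multilinear_form \<alpha>" and alt: "\<And>us x xs. \<alpha> (us @ x # x # xs) = 0"
    using assms by (auto simp: alternating_form_def)
  have "0 = \<alpha> (us @ (x + y) # (x + y) # xs)" using alt by simp
  also have "\<dots> = \<alpha> (us @ x # (x + y) # xs) + \<alpha> (us @ y # (x + y) # xs)"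
    by (rule multilinear_form_add[OF ml])
  also have "\<dots> = \<alpha> (us @ x # y # xs) + \<alpha> (us @ y # x # xs)"
    using multilinear_form_add[OF ml, of "us @ [x]" x y xs]
      multilinear_form_add[OF ml, of "us @ [y]" x y xs] alt
      by simp
  finally show ?thesis by (simp add: eq_neg_iff_add_eq_0)
qed

text \<open>The sign is left open because the lemma only serves to show that values vanish.\<close>

lemma alternating_form_move:
  assumes "alternating_form \<alpha>"
  shows "\<alpha> (us @ ys @ x # zs) = \<alpha> (us @ x # ys @ zs) \<or> \<alpha> (us @ ys @ x # zs) = - \<alpha> (us @ x # ys @ zs)"
proof (induction ys arbitrary: us)
  case (Cons y ys)
  have "\<alpha> (us @ y # x # ys @ zs) = - \<alpha> (us @ x # y # ys @ zs)"
    by (rule alternating_form_swap[OF assms])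
  then show ?case using Cons[of "us @ [y]"] by auto
qed simp

lemma alternating_form_not_distinct:
  assumes "alternating_form \<alpha>" "\<not> distinct vs"
  shows "\<alpha> vs = 0"
proof -
  obtain us y ys zs where vs: "vs = us @ y # ys @ y # zs"
    using not_distinct_decomp[OF assms(2)] by auto
  have "\<alpha> (us @ y # y # ys @ zs) = 0"
    using assms(1) by (simp add: alternating_form_def)
  then show ?thesis
    using alternating_form_move[OF assms(1), of "us @ [y]" ys y zs] by (auto simp: vs)
qed

lemma alternating_form_perm:
  assumes "alternating_form \<alpha>" "mset xs = mset ys"
  shows "\<alpha> (us @ xs) = \<alpha> (us @ ys) \<or> \<alpha> (us @ xs) = - \<alpha> (us @ ys)"
  using assms(2)
proof (induction xs arbitrary: us ys)
  case (Cons x xs)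
  then have "x \<in> set ys" by (metis list.set_intros(1) set_mset_mset)
  then obtain ys1 ys2 where ys: "ys = ys1 @ x # ys2" by (meson split_list)
  then have "mset xs = mset (ys1 @ ys2)" using Cons.prems by simp
  then have "\<alpha> ((us @ [x]) @ xs) = \<alpha> ((us @ [x]) @ ys1 @ ys2) \<or>
      \<alpha> ((us @ [x]) @ xs) = - \<alpha> ((us @ [x]) @ ys1 @ ys2)"
    by (rule Cons.IH)
  then show ?case
    using alternating_form_move[OF assms(1), of us ys1 x ys2] by (auto simp: ys)
qed simp

text \<open>The list is split into arbitrary vectors \<open>us\<close> and vectors \<open>ws\<close>
  from \<open>B\<close>; linearity in the last entry of \<open>us\<close> allows it to be exchanged
  for elements of \<open>B\<close>.\<close>

lemma multilinear_form_eq_0_on_span: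
  assumes "multilinear_form \<alpha>" "span B = UNIV"
    and "\<And>ws. length ws = n \<Longrightarrow> set ws \<subseteq> B \<Longrightarrow> \<alpha> ws = 0" and "length vs = n"
  shows "\<alpha> vs = 0"
proof -
  have "set ws \<subseteq> B \<Longrightarrow> length (us @ ws) = n \<Longrightarrow> \<alpha> (us @ ws) = 0" for us ws
  proof (induction us arbitrary: ws rule: rev_induct)
    case (snoc u us)
    have "linear (\<lambda>x. \<alpha> (us @ x # ws))"
      using assms(1) by (simp add: multilinear_form_def)
    moreover have "\<alpha> (us @ b # ws) = 0" if "b \<in> B" for b
      using snoc.IH[of "b # ws"] snoc.prems that by simp
    ultimately have "\<alpha> (us @ u # ws) = 0"
      using linear_eq_0_on_span[of "\<lambda>x. \<alpha> (us @ x # ws)" B u] assms(2) by auto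
    then show ?case by simp
  qed (use assms in simp)
  from this[of "[]" vs] assms(4) show ?thesis by simp
qed

text \<open>Top-degree forms make up at most a line: a list of entries of \<open>bs\<close>, of the
  length of \<open>bs\<close>, is either a permutation of \<open>bs\<close> or has a
  repetition.\<close>

lemma top_form_eq_0:
  assumes "alternating_form \<alpha>" "span (set bs) = UNIV" "\<alpha> bs = 0" "length vs = length bs"
  shows "\<alpha> vs = 0"
proof (rule multilinear_form_eq_0_on_span[OF _ assms(2) _ assms(4)])
  show "multilinear_form \<alpha>" using assms(1) by (simp add: alternating_form_def)
  fix ws assume ws: "length ws = length bs" "set ws \<subseteq> set bs"
  show "\<alpha> ws = 0"
  proof (cases "distinct ws")
    case True
    have "card (set bs) \<le> length bs" by (rule card_length)
    then have eq: "set ws = set bs"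
      using True ws by (metis List.finite_set card_seteq distinct_card)
    then have "distinct bs" using True ws by (metis card_distinct distinct_card)
    with True eq have "mset ws = mset bs" by (simp add: set_eq_iff_mset_eq_distinct)
    then show ?thesis using alternating_form_perm[OF assms(1), of ws bs "[]"] assms(3) by auto
  next
    case False
    then show ?thesis by (rule alternating_form_not_distinct[OF assms(1)])
  qed
qed

text \<open>Subsets are sorted by whether they contain 0. This recursion expands the shuffles in
  \<open>wedge\<close> as well as the sums in \<open>type_part\<close>.\<close>

lemma sum_Pow_lessThan_Suc:
  fixes f :: "nat set \<Rightarrow> 'b::comm_monoid_add"
  shows "(\<Sum>S\<in>Pow {..<Suc n}. f S) =
    (\<Sum>T\<in>Pow {..<n}. f (insert 0 (Suc ` T))) + (\<Sum>T\<in>Pow {..<n}. f (Suc ` T))"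
proof -
  have inj: "inj_on (\<lambda>T. insert 0 (Suc ` T)) (Pow {..<n})" "inj_on ((`) Suc) (Pow {..<n})"
    by (auto simp: inj_on_def)
  have "Pow (Suc ` {..<n}) = (`) Suc ` Pow {..<n}"
    by (rule image_Pow_surj[OF refl, symmetric])
  then have "Pow {..<Suc n} = (\<lambda>T. insert 0 (Suc ` T)) ` Pow {..<n} \<union> (`) Suc ` Pow {..<n}"
    by (simp add: lessThan_Suc_eq_insert_0 Pow_insert image_image Un_commute)
  moreover have "(\<lambda>T. insert 0 (Suc ` T)) ` Pow {..<n} \<inter> (`) Suc ` Pow {..<n} = {}" by auto
  ultimately show ?thesis
    by (simp add: sum.union_disjoint sum.reindex[OF inj(1)] sum.reindex[OF inj(2)])
qed

text \<open>The Leibniz rule for the interior product with \<open>x\<close>. It replaces the signs of shuffles by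
  inductions on the argument list.\<close>

lemma wedge_Cons:
  "(\<alpha> \<and>\<^sub>w \<beta>) (x # xs) = ((\<lambda>ys. \<alpha> (x # ys)) \<and>\<^sub>w \<beta>) xs +
    ((\<lambda>ys. (-1) ^ length ys * \<alpha> ys) \<and>\<^sub>w (\<lambda>ys. \<beta> (x # ys))) xs"
proof -
  let ?n = "length xs"
  let ?I = "\<lambda>S::nat set. {(i, j). i \<in> S \<and> j \<notin> S \<and> j < i}"
  let ?f = "\<lambda>S. (-1) ^ card (?I S) * \<alpha> (nths (x # xs) S) * \<beta> (nths (x # xs) (- S))"
  have 1: "?f (insert 0 (Suc ` T)) =
      (-1) ^ card (?I T) * \<alpha> (x # nths xs T) * \<beta> (nths xs (- T))" for T
  proof -
    have "(i, j) \<in> ?I (insert 0 (Suc ` T)) \<longleftrightarrow> (i, j) \<in> map_prod Suc Suc ` ?I T" for i j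
      by (cases i; cases j) auto
    from this[of "fst p" "snd p" for p] have "?I (insert 0 (Suc ` T)) = map_prod Suc Suc ` ?I T"
      unfolding prod.collapse by (rule set_eqI)
    then have "card (?I (insert 0 (Suc ` T))) = card (?I T)"
      by (simp add: card_image inj_on_def)
    moreover have "{j. Suc j \<in> insert 0 (Suc ` T)} = T" "{j. Suc j \<in> - insert 0 (Suc ` T)} = - T"
      by auto
    ultimately show ?thesis by (simp only: nths_Cons) simp
  qed
  \<comment> \<open>Here position 0 goes to \<open>\<beta>\<close>, so each element of
    \<open>T\<close> gains one inversion, the one with 0. The additional sign is determined by
    \<open>card T\<close>, the number of arguments that \<open>\<alpha>\<close> receives.\<close>
  have 2: "?f (Suc ` T) = (-1) ^ card (?I T) *
      ((-1) ^ length (nths xs T) * \<alpha> (nths xs T)) * \<beta> (x # nths xs (- T))"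
    if "T \<in> Pow {..<?n}" for T
  proof -
    have fin: "finite T" using that finite_subset by auto
    have "?I T \<subseteq> T \<times> {..<?n}" using that by auto
    then have "finite (?I T)"
      using fin by (meson finite_SigmaI finite_lessThan finite_subset)
    have "(i, j) \<in> ?I (Suc ` T) \<longleftrightarrow> (i, j) \<in> map_prod Suc Suc ` ?I T \<union> (\<lambda>i. (Suc i, 0)) ` T" for i j
      by (cases i; cases j) auto
    from this[of "fst p" "snd p" for p]
    have "?I (Suc ` T) = map_prod Suc Suc ` ?I T \<union> (\<lambda>i. (Suc i, 0)) ` T"
      unfolding prod.collapse by (rule set_eqI)
    moreover have "map_prod Suc Suc ` ?I T \<inter> (\<lambda>i. (Suc i, 0)) ` T = {}" by auto
    ultimately have "card (?I (Suc ` T)) = card (map_prod Suc Suc ` ?I T) + card ((\<lambda>i. (Suc i, 0::nat)) ` T)"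
      using fin \<open>finite (?I T)\<close> by (simp add: card_Un_disjoint)
    also have "\<dots> = card (?I T) + card T"
      by (simp add: card_image inj_on_def)
    finally have "card (?I (Suc ` T)) = card (?I T) + card T" .
    moreover have "length (nths xs T) = card T"
      using that by (auto simp: length_nths intro!: arg_cong[of _ _ card])
    moreover have "{j. Suc j \<in> Suc ` T} = T" "{j. Suc j \<in> - Suc ` T} = - T" by auto
    ultimately show ?thesis by (simp only: nths_Cons) (simp add: power_add algebra_simps)
  qed
  have "(\<alpha> \<and>\<^sub>w \<beta>) (x # xs) = (\<Sum>S\<in>Pow {..<Suc ?n}. ?f S)"
    by (simp add: wedge_def)
  also have "\<dots> = (\<Sum>T\<in>Pow {..<?n}. ?f (insert 0 (Suc ` T))) + (\<Sum>T\<in>Pow {..<?n}. ?f (Suc ` T))"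
    by (rule sum_Pow_lessThan_Suc)
  also have "(\<Sum>T\<in>Pow {..<?n}. ?f (Suc ` T)) = (\<Sum>T\<in>Pow {..<?n}. (-1) ^ card (?I T) *
      ((-1) ^ length (nths xs T) * \<alpha> (nths xs T)) * \<beta> (x # nths xs (- T)))"
    by (rule sum.cong[OF refl 2])
  finally show ?thesis by (simp only: 1) (simp add: wedge_def)
qed

lemma wedge_Nil: "(\<alpha> \<and>\<^sub>w \<beta>) [] = \<alpha> [] * \<beta> []"
  by (simp add: wedge_def)

lemma wedge_uminus_left: "((\<lambda>ys. - \<alpha> ys) \<and>\<^sub>w \<beta>) xs = - (\<alpha> \<and>\<^sub>w \<beta>) xs"
  and wedge_zero_left: "((\<lambda>ys. 0) \<and>\<^sub>w \<beta>) xs = 0"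
  and wedge_zero_right: "(\<alpha> \<and>\<^sub>w (\<lambda>ys. 0)) xs = 0"
  by (simp_all add: wedge_def sum_negf)

lemma has_degree_wedge:
  assumes "has_degree k \<alpha>" "has_degree l \<beta>"
  shows "has_degree (k + l) (\<alpha> \<and>\<^sub>w \<beta>)"
  unfolding has_degree_def
proof (intro allI impI)
  fix vs :: "'a list" assume len: "length vs \<noteq> k + l"
  have "length (nths vs S) + length (nths vs (- S)) = length vs" for S
  proof -
    have "card {i. i < length vs \<and> i \<in> S} + card {i. i < length vs \<and> i \<in> - S} =
        card ({i. i < length vs \<and> i \<in> S} \<union> {i. i < length vs \<and> i \<in> - S})"
      by (rule card_Un_disjoint[symmetric]) auto
    also have "{i. i < length vs \<and> i \<in> S} \<union> {i. i < length vs \<and> i \<in> - S} = {..<length vs}" by auto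
    finally show ?thesis by (simp add: length_nths)
  qed
  then have "\<alpha> (nths vs S) * \<beta> (nths vs (- S)) = 0" for S
    using assms len unfolding has_degree_def by (metis mult_zero_left mult_zero_right)
  then show "(\<alpha> \<and>\<^sub>w \<beta>) vs = 0"
    by (auto simp: wedge_def mult.assoc intro!: sum.neutral)
qed

lemma linear_wedge_left:
  fixes \<beta> :: "('e, 'b::{comm_ring_1, real_algebra_1}) form"
  assumes lin: "\<And>ys. linear (\<lambda>x. f x ys)"
  shows "linear (\<lambda>x. (f x \<and>\<^sub>w \<beta>) xs)"
proof -
  have "f (x + y) ys = f x ys + f y ys" "f (c *\<^sub>R x) ys = c *\<^sub>R f x ys" for x y c ys
    using linear_add[OF lin] linear_scale[OF lin] by auto
  then show ?thesis
    by (auto intro!: linearI simp: wedge_def algebra_simps sum.distrib scaleR_sum_right)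
qed

lemma linear_wedge_right:
  fixes \<alpha> :: "('e, 'b::{comm_ring_1, real_algebra_1}) form"
  assumes lin: "\<And>ys. linear (\<lambda>x. f x ys)"
  shows "linear (\<lambda>x. (\<alpha> \<and>\<^sub>w f x) xs)"
proof -
  have "f (x + y) ys = f x ys + f y ys" "f (c *\<^sub>R x) ys = c *\<^sub>R f x ys" for x y c ys
    using linear_add[OF lin] linear_scale[OF lin] by auto
  then show ?thesis
    by (auto intro!: linearI simp: wedge_def algebra_simps sum.distrib scaleR_sum_right)
qed

text \<open>Meant for the factor \<open>(-1) ^ length ys\<close> in \<open>wedge_Cons\<close>: it
  depends on the length alone, so it is constant while a single argument varies.\<close>

lemma alternating_form_scale:
  fixes \<alpha> :: "('e::real_vector, 'b::{comm_ring_1, real_algebra_1}) form"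
  assumes "alternating_form \<alpha>"
  shows "alternating_form (\<lambda>ys. f (length ys) * \<alpha> ys)"
proof -
  have lin: "linear (\<lambda>x. \<alpha> (us @ x # xs))" for us xs
    using assms by (simp add: alternating_form_def multilinear_form_def)
  show ?thesis
    using assms linear_compose_scale_right linear_add[OF lin] linear_scale[OF lin]
    by (auto simp: alternating_form_def multilinear_form_def algebra_simps intro!: linearI)
qed

lemma linear_wedge:
  fixes \<alpha> \<beta> :: "('e::real_vector, 'b::{comm_ring_1, real_algebra_1}) form"
  assumes "alternating_form \<alpha>" "alternating_form \<beta>"
  shows "linear (\<lambda>x. (\<alpha> \<and>\<^sub>w \<beta>) (us @ x # xs))"
  using assms
proof (induction us arbitrary: \<alpha> \<beta>)
  case Nil
  have "linear (\<lambda>x. \<alpha> ([] @ x # ys))" "linear (\<lambda>x. \<beta> ([] @ x # ys))" for ys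
    using Nil unfolding alternating_form_def multilinear_form_def by blast+
  then show ?case
    by (simp add: wedge_Cons linear_compose_add linear_wedge_left linear_wedge_right)
next
  case (Cons u us)
  then show ?case
    by (simp add: wedge_Cons linear_compose_add alternating_form_Cons
        alternating_form_scale[of _ "\<lambda>n. (-1) ^ n"])
qed

text \<open>When both equal arguments are at the front, two contractions leave only the mixed terms,
  where each factor receives one \<open>x\<close>. They cancel, since the sign by length changes
  when \<open>\<alpha>\<close> loses an argument.\<close>

lemma wedge_adjacent_eq_0:
  fixes \<alpha> \<beta> :: "('e::real_vector, 'b::{comm_ring_1, real_algebra_1}) form"
  assumes "alternating_form \<alpha>" "alternating_form \<beta>"
  shows "(\<alpha> \<and>\<^sub>w \<beta>) (us @ x # x # xs) = 0"
  using assms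
proof (induction us arbitrary: \<alpha> \<beta>)
  case Nil
  have "\<alpha> ([] @ x # x # ys) = 0" "\<beta> ([] @ x # x # ys) = 0" for ys
    using Nil unfolding alternating_form_def by blast+
  then show ?case
    by (simp add: wedge_Cons wedge_zero_left wedge_zero_right wedge_uminus_left)
next
  case (Cons u us)
  then show ?case
    by (simp add: wedge_Cons alternating_form_Cons alternating_form_scale[of _ "\<lambda>n. (-1) ^ n"])
qed

lemma alternating_form_wedge:
  fixes \<alpha> \<beta> :: "('e::real_vector, 'b::{comm_ring_1, real_algebra_1}) form"
  assumes "alternating_form \<alpha>" "alternating_form \<beta>"
  shows "alternating_form (\<alpha> \<and>\<^sub>w \<beta>)"
  unfolding alternating_form_def[of "\<alpha> \<and>\<^sub>w \<beta>"] multilinear_form_def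
  using linear_wedge[OF assms] wedge_adjacent_eq_0[OF assms] by blast

section \<open>The exterior derivative\<close>

lemma has_degree_ext_d:
  assumes "has_degree k \<alpha>"
  shows "has_degree (Suc k) (ext_d br \<alpha>)"
  unfolding has_degree_def
proof (intro allI impI)
  fix vs :: "'a list" assume len: "length vs \<noteq> Suc k"
  have "\<alpha> (br (vs ! i) (vs ! j) # nths vs (- {i, j})) = 0" if "i < j" "j < length vs" for i j
  proof -
    have "{l. l < length vs \<and> l \<in> - {i, j}} = {..<length vs} - {i, j}" by auto
    then have "length (nths vs (- {i, j})) = length vs - 2"
      using that by (simp add: length_nths card_Diff_subset)
    then show ?thesis
      using assms len that by (auto simp: has_degree_def)
  qed
  then show "ext_d br \<alpha> vs = 0"
    by (auto simp: ext_d_def intro!: sum.neutral)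
qed

text \<open>Forms such as \<open>delbar br J 1 1 \<omega>\<close> are computed only on lists of the
  right length; this carries such partial equalities through d.\<close>

lemma ext_d_cong:
  assumes "\<And>ws. Suc (length ws) = length vs \<Longrightarrow> \<alpha> ws = \<beta> ws"
  shows "ext_d br \<alpha> vs = ext_d br \<beta> vs"
proof -
  have "\<alpha> (br (vs ! i) (vs ! j) # nths vs (- {i, j})) = \<beta> (br (vs ! i) (vs ! j) # nths vs (- {i, j}))"
    if "i < j" "j < length vs" for i j
  proof -
    have "{l. l < length vs \<and> l \<in> - {i, j}} = {..<length vs} - {i, j}" by auto
    then have "length (nths vs (- {i, j})) = length vs - 2"
      using that by (simp add: length_nths card_Diff_subset)
    then show ?thesis
      using that by (intro assms) auto
  qed
  then show ?thesis
    by (auto simp: ext_d_def intro!: sum.cong)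
qed

lemma ext_d_add: "ext_d br (\<lambda>vs. \<alpha> vs + \<beta> vs) vs = ext_d br \<alpha> vs + ext_d br \<beta> vs"
  and ext_d_diff: "ext_d br (\<lambda>vs. \<alpha> vs - \<beta> vs) vs = ext_d br \<alpha> vs - ext_d br \<beta> vs"
  and ext_d_mult: "ext_d br (\<lambda>vs. c * \<alpha> vs) vs = c * ext_d br \<alpha> vs"
  by (simp_all add: ext_d_def algebra_simps sum.distrib sum_subtractf sum_negf sum_distrib_left)

lemma ext_d_of_real: "ext_d br (\<lambda>vs. of_real (\<alpha> vs)) vs = of_real (ext_d br \<alpha> vs)"
  by (simp add: ext_d_def)

lemma ext_d_3:
  "ext_d br \<alpha> [x, y, z] = - \<alpha> [br x y, z] + \<alpha> [br x z, y] - \<alpha> [br y z, x]"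
  by (simp add: ext_d_def lessThan_Suc nths_Cons)

lemma ext_d_4:
  "ext_d br \<alpha> [x, y, z, w] = - \<alpha> [br x y, z, w] + \<alpha> [br x z, y, w] - \<alpha> [br x w, y, z]
     - \<alpha> [br y z, x, w] + \<alpha> [br y w, x, z] - \<alpha> [br z w, x, y]"
  by (simp add: ext_d_def lessThan_Suc nths_Cons)

lemma ext_d_5:
  "ext_d br \<alpha> [x, y, z, w, u] =
     - \<alpha> [br x y, z, w, u] + \<alpha> [br x z, y, w, u] - \<alpha> [br x w, y, z, u] + \<alpha> [br x u, y, z, w]
     - \<alpha> [br y z, x, w, u] + \<alpha> [br y w, x, z, u] - \<alpha> [br y u, x, z, w]
     - \<alpha> [br z w, x, y, u] + \<alpha> [br z u, x, y, w] - \<alpha> [br w u, x, y, z]"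
  by (simp add: ext_d_def lessThan_Suc nths_Cons)

section \<open>Lie algebras, the Jacobi identity and d d = 0\<close>

lemma bilinear_alternating_swap:
  assumes "bilinear br" "\<And>x. br x x = 0"
  shows "br x y = - br y x"
proof -
  have "br (x + y) (x + y) = br x y + br y x"
    unfolding bilinear_ladd[OF assms(1)] bilinear_radd[OF assms(1)] by (simp add: assms(2))
  then show ?thesis by (metis assms(2) eq_neg_iff_add_eq_0)
qed

locale lie_algebra =
  fixes br :: "'e::real_vector \<Rightarrow> 'e \<Rightarrow> 'e"
  assumes bilinear: "bilinear br"
    and br_self: "br x x = 0"
    and jacobi: "br (br x y) z + br (br y z) x + br (br z x) y = 0"
begin

lemmas br_simps = bilinear_ladd[OF bilinear] bilinear_radd[OF bilinear]
  bilinear_lneg[OF bilinear] bilinear_rneg[OF bilinear] bilinear_lsub[OF bilinear] bilinear_rsub[OF bilinear]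
  bilinear_lzero[OF bilinear] bilinear_rzero[OF bilinear] bilinear_lmul[OF bilinear] bilinear_rmul[OF bilinear]

lemma br_swap: "br x y = - br y x"
  using bilinear_alternating_swap[OF bilinear br_self] .

lemma jacobi_right: "br (br y z) x = br (br x z) y - br (br x y) z"
proof -
  have "br (br z x) y = - br (br x z) y" by (subst br_swap[of z x]) (simp only: br_simps)
  then show ?thesis using jacobi[of x y z] by (simp only: algebra_simps) (metis add.commute add_minus_cancel add_uminus_conv_diff eq_neg_iff_add_eq_0 add.assoc)
qed

end

lemma alternating_form_simps:
  assumes "alternating_form \<alpha>"
  shows "\<alpha> (y # x # ws) = - \<alpha> (x # y # ws)" and "\<alpha> (x # x # ws) = 0"
    and "\<alpha> (v # x # x # ws) = 0" and "\<alpha> (x # y # x # ws) = 0"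
    and "\<alpha> (v # x # y # ws) = - \<alpha> (v # y # x # ws)"
    and "\<alpha> ((x + y) # ws) = \<alpha> (x # ws) + \<alpha> (y # ws)"
    and "\<alpha> ((x - y) # ws) = \<alpha> (x # ws) - \<alpha> (y # ws)"
    and "\<alpha> ((- x) # ws) = - \<alpha> (x # ws)" and "\<alpha> (0 # ws) = 0"
    and "\<alpha> ((c *\<^sub>R x) # ws) = c *\<^sub>R \<alpha> (x # ws)"
proof -
  have lin: "linear (\<lambda>x. \<alpha> (us @ x # xs))" and alt: "\<alpha> (us @ x # x # xs) = 0" for us x xs
    using assms unfolding alternating_form_def multilinear_form_def by blast+
  show "\<alpha> (y # x # ws) = - \<alpha> (x # y # ws)"
    using alternating_form_swap[OF assms, of "[]" y x ws] by simp
  show "\<alpha> (x # x # ws) = 0" using alt[of "[]"] by simp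
  show "\<alpha> (v # x # x # ws) = 0" using alt[of "[v]"] by simp
  show "\<alpha> (v # x # y # ws) = - \<alpha> (v # y # x # ws)"
    using alternating_form_swap[OF assms, of "[v]" x y ws] by simp
  show "\<alpha> (x # y # x # ws) = 0"
    using alternating_form_swap[OF assms, of "[x]" x y ws] alt[of "[]" x "y # ws"] by simp
  note lin' = lin[of "[]" ws, simplified]
  show "\<alpha> ((x + y) # ws) = \<alpha> (x # ws) + \<alpha> (y # ws)" using linear_add[OF lin'] .
  show "\<alpha> ((x - y) # ws) = \<alpha> (x # ws) - \<alpha> (y # ws)" using linear_diff[OF lin'] .
  show "\<alpha> ((- x) # ws) = - \<alpha> (x # ws)" using linear_neg[OF lin'] .
  show "\<alpha> (0 # ws) = 0" using linear_0[OF lin'] .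
  show "\<alpha> ((c *\<^sub>R x) # ws) = c *\<^sub>R \<alpha> (x # ws)" using linear_scale[OF lin'] .
qed

context lie_algebra begin

text \<open>Terms with a nested bracket cancel by the Jacobi identity, one instance for each of the
  four triples. Terms with two separate brackets occur twice in opposite order and cancel by
  antisymmetry, one instance for each of the three splittings into pairs.\<close>

lemma ext_d_ext_d_2:
  fixes \<alpha> :: "('e, 'b::{comm_ring_1, real_algebra_1}) form"
  assumes "alternating_form \<alpha>"
  shows "ext_d br (ext_d br \<alpha>) [a, b, c, d] = 0"
proof -
  note jac = jacobi_right[of b c a] jacobi_right[of b d a] jacobi_right[of c d a] jacobi_right[of c d b]
  show ?thesis
    unfolding ext_d_3 ext_d_4 jac alternating_form_simps(6-9)[OF assms]
      alternating_form_simps(1)[OF assms, of "br c d" "br a b"]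
      alternating_form_simps(1)[OF assms, of "br b d" "br a c"]
      alternating_form_simps(1)[OF assms, of "br b c" "br a d"]
    by simp
qed

text \<open>The same cancellation with ten triples for the Jacobi identity and fifteen choices of
  two disjoint pairs for antisymmetry.\<close>

lemma ext_d_ext_d_3:
  fixes \<alpha> :: "('e, 'b::{comm_ring_1, real_algebra_1}) form"
  assumes "alternating_form \<alpha>"
  shows "ext_d br (ext_d br \<alpha>) [a, b, c, d, e] = 0"
proof -
  note jac = jacobi_right[of b c a] jacobi_right[of b d a] jacobi_right[of c d a] jacobi_right[of c d b]
    jacobi_right[of b e a] jacobi_right[of c e a] jacobi_right[of d e a]
    jacobi_right[of c e b] jacobi_right[of d e b] jacobi_right[of d e c]
  note sw = alternating_form_simps(1)[OF assms, of _ _ "[_]"]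
  show ?thesis
    unfolding ext_d_4 ext_d_5 jac alternating_form_simps(6-9)[OF assms]
      sw[of "br c d" "br a b"] sw[of "br c e" "br a b"] sw[of "br d e" "br a b"]
      sw[of "br b d" "br a c"] sw[of "br b e" "br a c"] sw[of "br d e" "br a c"]
      sw[of "br b c" "br a d"] sw[of "br b e" "br a d"] sw[of "br c e" "br a d"]
      sw[of "br b c" "br a e"] sw[of "br b d" "br a e"] sw[of "br c d" "br a e"]
      sw[of "br d e" "br b c"] sw[of "br c e" "br b d"] sw[of "br c d" "br b e"]
    by simp
qed

end

text \<open>Stated for any alternating bilinear \<open>br\<close>, so that it also covers the
  deformed bracket \<open>J_bracket J br\<close>.\<close>

lemma ext_d_alternating_3:
  fixes \<alpha> :: "('e::real_vector, 'b::{comm_ring_1, real_algebra_1}) form"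
  assumes \<alpha>: "alternating_form \<alpha>" "has_degree 2 \<alpha>" and br: "bilinear br" "\<And>x. br x x = 0"
  shows "alternating_form (ext_d br \<alpha>)"
proof -
  have deg: "has_degree 3 (ext_d br \<alpha>)"
    using has_degree_ext_d[OF \<alpha>(2)] by (simp add: eval_nat_numeral)
  note br_simps = bilinear_ladd[OF br(1)] bilinear_radd[OF br(1)]
    bilinear_lmul[OF br(1)] bilinear_rmul[OF br(1)]
  have \<alpha>2: "\<alpha> [z, x + y] = \<alpha> [z, x] + \<alpha> [z, y]" "\<alpha> [z, c *\<^sub>R x] = c *\<^sub>R \<alpha> [z, x]" for x y z c
    using alternating_form_simps(1)[OF \<alpha>(1), of z _ "[]"] alternating_form_simps(6,10)[OF \<alpha>(1), of _ _ "[z]"]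
    by (simp_all)
  have "linear (\<lambda>x. ext_d br \<alpha> (us @ x # xs))" for us xs
  proof (cases "length (us @ undefined # xs) = 3")
    case True
    then consider y z where "us = []" "xs = [y, z]" | y z where "us = [y]" "xs = [z]"
      | y z where "us = [y, z]" "xs = []"
    proof -
      have "length us + length xs = 2" using True by simp
      then have "length us = 0 \<and> length xs = 2 \<or> length us = 1 \<and> length xs = 1 \<or> length us = 2 \<and> length xs = 0"
        by arith
      then show ?thesis
        using that by (auto simp: length_Suc_conv numeral_2_eq_2)
    qed
    then show ?thesis
      by cases (auto intro!: linearI simp: ext_d_3 br_simps \<alpha>2 alternating_form_simps(6,10)[OF \<alpha>(1)]
          algebra_simps)
  next
    case False
    then have "(\<lambda>x. ext_d br \<alpha> (us @ x # xs)) = (\<lambda>x. 0)"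
      using deg by (auto simp: has_degree_def)
    then show ?thesis by (simp add: linear_zero)
  qed
  moreover have "ext_d br \<alpha> (us @ x # x # xs) = 0" for us x xs
  proof (cases "length (us @ x # x # xs) = 3")
    case True
    then consider z where "us = []" "xs = [z]" | z where "us = [z]" "xs = []"
    proof -
      have "length us + length xs = 1" using True by simp
      then have "length us = 0 \<and> length xs = 1 \<or> length us = 1 \<and> length xs = 0"
        by arith
      then show ?thesis
        using that by (auto simp: length_Suc_conv)
    qed
    then show ?thesis
      by cases (auto simp: ext_d_3 br(2) alternating_form_simps(9)[OF \<alpha>(1)])
  next
    case False
    then show ?thesis using deg by (auto simp: has_degree_def)
  qed
  ultimately show ?thesis
    by (simp add: alternating_form_def multilinear_form_def)
qed

section \<open>The complex structure\<close>

definition J_derivation :: "('e \<Rightarrow> 'e) \<Rightarrow> ('e, 'b::comm_monoid_add) form \<Rightarrow> ('e, 'b) form" where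
  "J_derivation J \<alpha> vs = (\<Sum>i<length vs. \<alpha> (vs[i := J (vs ! i)]))"

text \<open>The bracket deformed by \<open>J\<close> in the sense of Nijenhuis. For integrable
  \<open>J\<close> its differential is i(\<partial> - \<partial>-bar), a real operator in the role
  of d^c.\<close>

definition J_bracket :: "('e \<Rightarrow> 'e) \<Rightarrow> ('e \<Rightarrow> 'e \<Rightarrow> 'e) \<Rightarrow> 'e \<Rightarrow> 'e \<Rightarrow> 'e::real_vector" where
  "J_bracket J br x y = br (J x) y + br x (J y) - J (br x y)"

lemma J_derivation_2: "J_derivation J \<alpha> [x, y] = \<alpha> [J x, y] + \<alpha> [x, J y]"
  and J_derivation_3: "J_derivation J \<alpha> [x, y, z] = \<alpha> [J x, y, z] + \<alpha> [x, J y, z] + \<alpha> [x, y, J z]"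
  and J_derivation_4: "J_derivation J \<alpha> [x, y, z, w] =
    \<alpha> [J x, y, z, w] + \<alpha> [x, J y, z, w] + \<alpha> [x, y, J z, w] + \<alpha> [x, y, z, J w]"
  by (simp_all add: J_derivation_def lessThan_Suc algebra_simps)

text \<open>Terms where \<open>J\<close> hits an argument outside the bracket agree on both sides.
  Where it hits one inside, the comparison with \<open>J\<close> applied to the bracket leaves
  exactly \<open>J_bracket\<close>.\<close>

lemma J_derivation_ext_d_3:
  fixes \<alpha> :: "('e::real_vector, 'b::{comm_ring_1, real_algebra_1}) form"
  assumes "alternating_form \<alpha>"
  shows "J_derivation J (ext_d br \<alpha>) [x, y, z] =
    ext_d br (J_derivation J \<alpha>) [x, y, z] + ext_d (J_bracket J br) \<alpha> [x, y, z]"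
  by (simp add: J_derivation_2 J_derivation_3 ext_d_3 J_bracket_def
      alternating_form_simps(6,7)[OF assms] algebra_simps)

lemma J_derivation_ext_d_4:
  fixes \<alpha> :: "('e::real_vector, 'b::{comm_ring_1, real_algebra_1}) form"
  assumes "alternating_form \<alpha>"
  shows "J_derivation J (ext_d br \<alpha>) [x, y, z, w] =
    ext_d br (J_derivation J \<alpha>) [x, y, z, w] + ext_d (J_bracket J br) \<alpha> [x, y, z, w]"
  by (simp add: J_derivation_3 J_derivation_4 ext_d_4 J_bracket_def
      alternating_form_simps(6,7)[OF assms] algebra_simps)

section \<open>Projections to the types (1,2) and (2,2)\<close>

lemma sum_subsets_card:
  "finite A \<Longrightarrow> (\<Sum>S\<in>{S. S \<subseteq> A \<and> card S = p}. f S) = (\<Sum>S\<in>Pow A. if card S = p then f S else 0)"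
  by (simp add: sum.inter_filter[symmetric] Pow_def)

lemma multilinear_neg_neg:
  assumes "multilinear_form \<alpha>" "\<And>x. J (J x) = - x"
  shows "\<alpha> (us @ J (J x) # xs) = - \<alpha> (us @ x # xs)"
  using assms linear_neg[of "\<lambda>x. \<alpha> (us @ x # xs)"] by (simp add: multilinear_form_def)

text \<open>The pattern \<open>us @ x # xs\<close> does not match a literal list, hence the
  instances for the four leading positions.\<close>

lemmas multilinear_neg_neg_simps =
  multilinear_neg_neg[where us = "[]", simplified]
  multilinear_neg_neg[where us = "[v1]" for v1, simplified]
  multilinear_neg_neg[where us = "[v1, v2]" for v1 v2, simplified]
  multilinear_neg_neg[where us = "[v1, v2, v3]" for v1 v2 v3, simplified]

lemma multilinear_form_half:
  assumes "multilinear_form \<alpha>"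
  shows "\<alpha> (us @ (1/2) *\<^sub>R x # xs) = (1/2) *\<^sub>R \<alpha> (us @ x # xs)"
    "\<alpha> (us @ - ((1/2) *\<^sub>R x) # xs) = - ((1/2) *\<^sub>R \<alpha> (us @ x # xs))"
  using assms linear_scale[of "\<lambda>x. \<alpha> (us @ x # xs)"] linear_neg[of "\<lambda>x. \<alpha> (us @ x # xs)"]
  by (simp_all add: multilinear_form_def)

lemmas multilinear_form_half_simps =
  multilinear_form_half[where us = "[]", simplified]
  multilinear_form_half[where us = "[v1]" for v1, simplified]
  multilinear_form_half[where us = "[v1, v2]" for v1 v2, simplified]
  multilinear_form_half[where us = "[v1, v2, v3]" for v1 v2 v3, simplified]

text \<open>Each \<open>J\<close> contributes -i at a position in \<open>S\<close> and i elsewhere.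
  The coefficients are the sums of these products over the three sets \<open>S\<close>; 1/8 collects
  the halves in \<open>vec10\<close> and \<open>vec01\<close>.\<close>

lemma type_part_1_2:
  assumes "multilinear_form \<alpha>"
  shows "type_part J 1 2 \<alpha> [x, y, z] = (1/8) *
    (3 * \<alpha> [x, y, z] + \<i> * (\<alpha> [J x, y, z] + \<alpha> [x, J y, z] + \<alpha> [x, y, J z])
     + (\<alpha> [J x, J y, z] + \<alpha> [J x, y, J z] + \<alpha> [x, J y, J z]) + 3 * \<i> * \<alpha> [J x, J y, J z])"
  by (simp add: type_part_def sum_subsets_card numeral_3_eq_3 sum_Pow_lessThan_Suc
      card_insert_if upt_rec vec10_def vec01_def multilinear_form_half_simps[OF assms]
      scaleR_conv_of_real algebra_simps)

lemma type_part_2_2: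
  assumes "multilinear_form \<alpha>"
  shows "type_part J 2 2 \<alpha> [x, y, z, w] = (1/8) *
    (3 * \<alpha> [x, y, z, w] + (\<alpha> [J x, J y, z, w] + \<alpha> [J x, y, J z, w] + \<alpha> [J x, y, z, J w]
     + \<alpha> [x, J y, J z, w] + \<alpha> [x, J y, z, J w] + \<alpha> [x, y, J z, J w]) + 3 * \<alpha> [J x, J y, J z, J w])"
  by (simp add: type_part_def sum_subsets_card eval_nat_numeral sum_Pow_lessThan_Suc
      card_insert_if upt_rec vec10_def vec01_def multilinear_form_half_simps[OF assms]
      scaleR_conv_of_real algebra_simps)

lemma list_3_cases:
  assumes "length vs = 3" obtains x y z where "vs = [x, y, z]"
  using assms by (auto simp: length_Suc_conv numeral_3_eq_3)

lemma list_4_cases: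
  assumes "length vs = 4" obtains x y z w where "vs = [x, y, z, w]"
  using assms by (auto simp: length_Suc_conv eval_nat_numeral)

lemma list_5_cases:
  assumes "length vs = 5" obtains x y z w u where "vs = [x, y, z, w, u]"
  using assms by (auto simp: length_Suc_conv eval_nat_numeral)

text \<open>On forms of type \<open>(2,1) + (1,2)\<close> the derivation \<open>D\<close> induced by \<open>J\<close> acts by \<open>\<i>\<close> and \<open>-\<i>\<close>, so the
  projection to type \<open>(1,2)\<close> is \<open>(1 + \<i>D)/2\<close>.\<close>

lemma type_part_1_2_J_derivation:
  assumes \<theta>: "multilinear_form \<theta>" and J: "\<And>x. J (J x) = - x"
    and DD: "\<And>x y z. J_derivation J (J_derivation J \<theta>) [x, y, z] = - \<theta> [x, y, z]"
  shows "type_part J 1 2 \<theta> [x, y, z] = (1/2) * (\<theta> [x, y, z] + \<i> * J_derivation J \<theta> [x, y, z])"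
proof -
  note neg = multilinear_neg_neg_simps[OF \<theta>, of J, OF J]
  \<comment> \<open>With E the left-hand side, D D \<theta> expands to -3\<theta> + 2E, so the
    hypothesis \<open>DD\<close> says E = \<theta>. It excludes the types (3,0) and (0,3), on which
    D D is -9.\<close>
  have 2: "\<theta> [J x, J y, z] + \<theta> [J x, y, J z] + \<theta> [x, J y, J z] = \<theta> [x, y, z]" for x y z
  proof -
    have "2 * (\<theta> [J x, J y, z] + \<theta> [J x, y, J z] + \<theta> [x, J y, J z]) = 2 * \<theta> [x, y, z]"
      using DD[of x y z] by (simp add: J_derivation_3 neg algebra_simps)
    then show ?thesis by (simp only: mult_cancel_left) simp
  qed
  have 3: "\<theta> [J x, J y, J z] = \<theta> [J x, y, z] + \<theta> [x, J y, z] + \<theta> [x, y, J z]"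
    using 2[of "J x" y z] 2[of x "J y" z] 2[of x y "J z"] by (simp add: neg algebra_simps)
  show ?thesis
    by (simp only: type_part_1_2[OF \<theta>] J_derivation_3 2 3) (simp add: field_simps)
qed

text \<open>The derivation acts on type (p,q) by i(p - q), so in degree four its kernel is the type
  (2,2). In real terms this means \<open>?E = 2 * \<gamma>\<close> and invariance of
  \<open>\<gamma>\<close> under \<open>J\<close> in all four arguments, which turns the expanded
  projection into (3 + 2 + 3)/8 = 1.\<close>

lemma type_part_2_2_eq:
  assumes \<gamma>: "multilinear_form \<gamma>" and J: "\<And>x. J (J x) = - x"
    and D: "\<And>x y z w. J_derivation J \<gamma> [x, y, z, w] = 0"
  shows "type_part J 2 2 \<gamma> [x, y, z, w] = \<gamma> [x, y, z, w]"
proof -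
  note neg = multilinear_neg_neg_simps[OF \<gamma>, of J, OF J]
  let ?E = "\<lambda>x y z w. \<gamma> [J x, J y, z, w] + \<gamma> [J x, y, J z, w] + \<gamma> [J x, y, z, J w]
     + \<gamma> [x, J y, J z, w] + \<gamma> [x, J y, z, J w] + \<gamma> [x, y, J z, J w]"
  have 2: "?E x y z w = 2 * \<gamma> [x, y, z, w]" for x y z w
  proof -
    have "J_derivation J \<gamma> [J x, y, z, w] + J_derivation J \<gamma> [x, J y, z, w] +
        J_derivation J \<gamma> [x, y, J z, w] + J_derivation J \<gamma> [x, y, z, J w] = 0"
      by (simp add: D)
    then have "2 * ?E x y z w - 2 * (2 * \<gamma> [x, y, z, w]) = 0"
      by (simp only: J_derivation_4 neg) (simp add: algebra_simps)
    then show ?thesis by (simp only: right_minus_eq mult_cancel_left) simp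
  qed
  \<comment> \<open>Relation \<open>2\<close> is applied with \<open>J\<close> inserted at each of
    the six pairs of positions. On the left, a coinciding pair gives \<open>\<gamma>\<close>, pairs
    sharing one position give -4 \<open>?E\<close> altogether, and complementary pairs give the term
    with four \<open>J\<close>.\<close>
  have "?E (J x) (J y) z w + ?E (J x) y (J z) w + ?E (J x) y z (J w) + ?E x (J y) (J z) w
      + ?E x (J y) z (J w) + ?E x y (J z) (J w) = 4 * \<gamma> [x, y, z, w]"
    unfolding 2 using arg_cong[OF 2[of x y z w], of "(*) 2"] by (simp add: algebra_simps)
  then have "6 * \<gamma> [x, y, z, w] - 4 * ?E x y z w + 6 * \<gamma> [J x, J y, J z, J w] = 4 * \<gamma> [x, y, z, w]"
    by (simp only: neg) (simp add: algebra_simps)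
  then have "6 * \<gamma> [J x, J y, J z, J w] = 6 * \<gamma> [x, y, z, w]"
    unfolding 2 by simp
  then have "\<gamma> [J x, J y, J z, J w] = \<gamma> [x, y, z, w]" by simp
  with 2[of x y z w] show ?thesis
    by (simp only: type_part_2_2[OF \<gamma>]) simp
qed

lemma has_degree_type_part: "has_degree (p + q) (type_part J p q \<alpha>)"
  by (simp add: has_degree_def type_part_def)

lemma type_part_cong:
  assumes "\<And>ws. length ws = length vs \<Longrightarrow> \<alpha> ws = \<beta> ws"
  shows "type_part J p q \<alpha> vs = type_part J p q \<beta> vs"
proof -
  have *: "complex_ext \<alpha> ws = complex_ext \<beta> ws"
    if "\<And>us. length us = length ws \<Longrightarrow> \<alpha> us = \<beta> us" for \<alpha> \<beta> and ws :: "('a \<times> 'a) list"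
    using that
  proof (induction ws arbitrary: \<alpha> \<beta>)
    case (Cons w ws)
    obtain u v where w: "w = (u, v)" by fastforce
    have "complex_ext (\<lambda>xs. \<alpha> (u # xs)) ws = complex_ext (\<lambda>xs. \<beta> (u # xs)) ws"
        "complex_ext (\<lambda>xs. \<alpha> (v # xs)) ws = complex_ext (\<lambda>xs. \<beta> (v # xs)) ws"
      by (rule Cons.IH; simp add: Cons.prems)+
    then show ?case by (simp add: w)
  qed simp
  show ?thesis
    unfolding type_part_def by (auto intro!: sum.cong * assms)
qed

lemma alternating_form_linear_combination:
  fixes \<alpha> \<beta> :: "('e::real_vector, 'b::{comm_ring_1, real_algebra_1}) form"
  assumes "alternating_form \<alpha>" "alternating_form \<beta>"
  shows "alternating_form (\<lambda>vs. a * \<alpha> vs + b * \<beta> vs)"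
proof -
  have \<alpha>: "linear (\<lambda>x. \<alpha> (us @ x # xs))" and \<beta>: "linear (\<lambda>x. \<beta> (us @ x # xs))" for us xs
    using assms by (simp_all add: alternating_form_def multilinear_form_def)
  show ?thesis
    using assms linear_add[OF \<alpha>] linear_scale[OF \<alpha>] linear_add[OF \<beta>] linear_scale[OF \<beta>]
    by (auto simp: alternating_form_def multilinear_form_def algebra_simps intro!: linearI)
qed

lemma multilinear_form_ext_d_4:
  fixes \<alpha> :: "('e::real_vector, 'b::{comm_ring_1, real_algebra_1}) form"
  assumes \<alpha>: "alternating_form \<alpha>" "has_degree 3 \<alpha>" and br: "bilinear br"
  shows "multilinear_form (ext_d br \<alpha>)"
proof -
  have deg: "has_degree 4 (ext_d br \<alpha>)"
    using has_degree_ext_d[OF \<alpha>(2)] by (simp add: eval_nat_numeral)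
  note br_simps = bilinear_ladd[OF br] bilinear_radd[OF br] bilinear_lmul[OF br] bilinear_rmul[OF br]
  have lin: "linear (\<lambda>x. \<alpha> (us @ x # xs))" for us xs
    using \<alpha>(1) by (simp add: alternating_form_def multilinear_form_def)
  note \<alpha>_simps = alternating_form_simps(6,10)[OF \<alpha>(1)]
    linear_add[OF lin[of "[v]" for v], simplified] linear_add[OF lin[of "[v, w]" for v w], simplified]
    linear_scale[OF lin[of "[v]" for v], simplified] linear_scale[OF lin[of "[v, w]" for v w], simplified]
  have "linear (\<lambda>x. ext_d br \<alpha> (us @ x # xs))" for us xs
  proof (cases "length (us @ undefined # xs) = 4")
    case True
    then consider y z w where "us = []" "xs = [y, z, w]" | y z w where "us = [y]" "xs = [z, w]"
      | y z w where "us = [y, z]" "xs = [w]" | y z w where "us = [y, z, w]" "xs = []"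
    proof -
      have "length us + length xs = 3" using True by simp
      then have "length us = 0 \<and> length xs = 3 \<or> length us = 1 \<and> length xs = 2 \<or>
          length us = 2 \<and> length xs = 1 \<or> length us = 3 \<and> length xs = 0"
        by arith
      then show ?thesis
        using that by (auto simp: length_Suc_conv eval_nat_numeral)
    qed
    then show ?thesis
      by cases (auto intro!: linearI simp: ext_d_4 br_simps \<alpha>_simps algebra_simps)
  next
    case False
    then have "(\<lambda>x. ext_d br \<alpha> (us @ x # xs)) = (\<lambda>x. 0)"
      using deg by (auto simp: has_degree_def)
    then show ?thesis by (simp add: linear_zero)
  qed
  then show ?thesis by (simp add: multilinear_form_def)
qed

text \<open>The double deformation equals twice the Nijenhuis tensor minus \<open>br\<close>.
  Integrability of \<open>J\<close> enters the argument here and nowhere else.\<close>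

lemma J_bracket_J_bracket:
  assumes "complex_structure br J" "bilinear br"
  shows "J_bracket J (J_bracket J br) x y = - br x y"
proof -
  have J: "linear J" "\<And>x. J (J x) = - x"
    and N: "br (J x) (J y) - J (br (J x) y) - J (br x (J y)) - br x y = 0"
    using assms by (auto simp: complex_structure_def)
  have "J_bracket J (J_bracket J br) x y =
      2 *\<^sub>R (br (J x) (J y) - J (br (J x) y) - J (br x (J y)) - br x y) - br x y"
    by (simp add: J_bracket_def J linear_add[OF J(1)] linear_diff[OF J(1)] bilinear_lneg[OF assms(2)]
        bilinear_rneg[OF assms(2)] algebra_simps scaleR_2)
  then show ?thesis by (simp add: N)
qed

lemma bilinear_J_bracket:
  assumes "linear J" "bilinear br" "\<And>x. br x x = 0"
  shows "bilinear (J_bracket J br)" "J_bracket J br x x = 0"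
proof -
  note br_simps = bilinear_ladd[OF assms(2)] bilinear_radd[OF assms(2)]
    bilinear_lmul[OF assms(2)] bilinear_rmul[OF assms(2)]
    linear_add[OF assms(1)] linear_scale[OF assms(1)]
  show "bilinear (J_bracket J br)"
    by (auto simp: bilinear_def J_bracket_def br_simps algebra_simps intro!: linearI)
  show "J_bracket J br x x = 0"
    using bilinear_alternating_swap[OF assms(2,3), of "J x" x]
    by (simp add: J_bracket_def assms(3) linear_0[OF assms(1)])
qed

text \<open>Write \<open>d\<close> and \<open>c\<close> for the differentials of \<open>br\<close> and \<open>J_bracket J br\<close>, and \<open>D\<close> for the derivation
  induced by \<open>J\<close>. Integrability gives \<open>[D, d] = c\<close> and \<open>[D, c] = - d\<close>, so \<open>D d \<omega> = c \<omega>\<close> and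
  \<open>D d c \<omega> = c c \<omega> = 0\<close> for a form \<open>\<omega>\<close> of type \<open>(1,1)\<close>. Thus \<open>d\<close> maps the \<open>(1,2)\<close>-part of \<open>d \<omega>\<close> to a
  form of type \<open>(2,2)\<close>, and the projection in the definition of \<open>\<partial>\<close> does nothing.\<close>

lemma (in lie_algebra) ext_d_del_delbar:
  assumes cs: "complex_structure br J"
    and \<omega>: "alternating_form \<omega>" "has_degree 2 \<omega>" "\<And>x y. \<omega> [J x, J y] = \<omega> [x, y]"
  shows "ext_d br (del br J 1 2 (delbar br J 1 1 \<omega>)) vs = 0"
proof -
  have J: "linear J" "\<And>x. J (J x) = - x" using cs by (auto simp: complex_structure_def)
  define brc where "brc = J_bracket J br"
  define \<theta> where "\<theta> = ext_d br \<omega>"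
  define \<kappa> where "\<kappa> = ext_d brc \<omega>"
  note brc = bilinear_J_bracket[OF J(1) bilinear br_self, folded brc_def]
  have brcc: "J_bracket J brc = (\<lambda>x y. - br x y)"
    using J_bracket_J_bracket[OF cs bilinear] by (auto simp: brc_def)
  have alt: "alternating_form \<theta>" "alternating_form \<kappa>"
    unfolding \<theta>_def \<kappa>_def by (intro ext_d_alternating_3 \<omega> bilinear br_self brc)+
  have ml: "multilinear_form \<theta>" "multilinear_form \<kappa>" using alt by (auto simp: alternating_form_def)
  have deg: "has_degree 3 \<theta>" "has_degree 3 \<kappa>"
    unfolding \<theta>_def \<kappa>_def using has_degree_ext_d[OF \<omega>(2)] by (auto simp: eval_nat_numeral)
  have minus_3: "ext_d (\<lambda>x y. - br x y) \<omega> [x, y, z] = - \<theta> [x, y, z]" for x y z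
    by (simp add: \<theta>_def ext_d_3 alternating_form_simps(8)[OF \<omega>(1)])
  have minus_4: "ext_d (\<lambda>x y. - br x y) \<theta> [x, y, z, w] = - ext_d br \<theta> [x, y, z, w]" for x y z w
    by (simp add: ext_d_4 alternating_form_simps(8)[OF alt(1)])
  have dd: "ext_d br \<theta> [x, y, z, w] = 0" for x y z w
    unfolding \<theta>_def by (rule ext_d_ext_d_2[OF \<omega>(1)])
  \<comment> \<open>Type (1,1), expressed by the derivation.\<close>
  have D\<omega>: "J_derivation J \<omega> [x, y] = 0" for x y
  proof -
    have "\<omega> [J x, y] = - \<omega> [x, J y]"
      using \<omega>(3)[of "J x" y] alternating_form_simps(8)[OF \<omega>(1), of x "[J y]"] by (simp add: J)
    then show ?thesis by (simp add: J_derivation_2)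
  qed
  have D\<theta>: "J_derivation J \<theta> [x, y, z] = \<kappa> [x, y, z]" for x y z
    using J_derivation_ext_d_3[OF \<omega>(1), of J br x y z]
    by (simp add: \<theta>_def \<kappa>_def brc_def[symmetric] ext_d_3[of br "J_derivation J \<omega>"] D\<omega>)
  have D\<kappa>: "J_derivation J \<kappa> [x, y, z] = - \<theta> [x, y, z]" for x y z
    using J_derivation_ext_d_3[OF \<omega>(1), of J brc x y z]
    by (simp add: \<kappa>_def brcc ext_d_3[of _ "J_derivation J \<omega>"] D\<omega> minus_3)
  have Dd\<kappa>: "J_derivation J (ext_d br \<kappa>) [x, y, z, w] = ext_d brc \<kappa> [x, y, z, w]" for x y z w
  proof -
    have "ext_d br (J_derivation J \<kappa>) [x, y, z, w] = - ext_d br \<theta> [x, y, z, w]"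
      by (simp add: ext_d_4 D\<kappa>)
    then show ?thesis
      using J_derivation_ext_d_4[OF alt(2), of J br x y z w] by (simp add: dd brc_def[symmetric])
  qed
  have c\<theta>: "ext_d brc \<theta> [x, y, z, w] = - ext_d br \<kappa> [x, y, z, w]" for x y z w
  proof -
    have "ext_d br (J_derivation J \<theta>) [x, y, z, w] = ext_d br \<kappa> [x, y, z, w]"
      by (simp add: ext_d_4 D\<theta>)
    moreover have "J_derivation J (ext_d br \<theta>) [x, y, z, w] = 0"
      by (simp add: J_derivation_4 dd)
    ultimately show ?thesis
      using J_derivation_ext_d_4[OF alt(1), of J br x y z w]
      by (simp add: brc_def[symmetric] eq_neg_iff_add_eq_0 add.commute)
  qed
  \<comment> \<open>D c \<theta> is evaluated in two ways: [D, c] = -d and d \<theta> = 0 give c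
    \<kappa>, while c \<theta> = -d \<kappa> gives -D d \<kappa> = -c \<kappa>.\<close>
  have cc: "ext_d brc \<kappa> [x, y, z, w] = 0" for x y z w
  proof -
    have "ext_d brc (J_derivation J \<theta>) [x, y, z, w] = ext_d brc \<kappa> [x, y, z, w]"
      by (simp add: ext_d_4 D\<theta>)
    then have "J_derivation J (ext_d brc \<theta>) [x, y, z, w] = ext_d brc \<kappa> [x, y, z, w]"
      using J_derivation_ext_d_4[OF alt(1), of J brc x y z w] by (simp add: brcc minus_4 dd)
    moreover have "J_derivation J (ext_d brc \<theta>) [x, y, z, w] = - J_derivation J (ext_d br \<kappa>) [x, y, z, w]"
      by (simp add: J_derivation_4 c\<theta>)
    ultimately show ?thesis using Dd\<kappa>[of x y z w] by simp
  qed
  \<comment> \<open>This is (1 + iD)/2 applied to \<open>\<theta>\<close>, the (1,2)-part of d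
    \<omega>.\<close>
  define \<beta> where "\<beta> = (\<lambda>vs. (1/2) * \<theta> vs + (\<i>/2) * \<kappa> vs)"
  have \<beta>: "alternating_form \<beta>" "has_degree 3 \<beta>"
    unfolding \<beta>_def using deg
    by (auto intro: alternating_form_linear_combination alt simp: has_degree_def simp del: times_divide_eq_left)
  have delbar: "delbar br J 1 1 \<omega> us = \<beta> us" if "length us = 3" for us
  proof -
    obtain x y z where us: "us = [x, y, z]" using list_3_cases \<open>length us = 3\<close> by blast
    have "J_derivation J (J_derivation J \<theta>) [x, y, z] = - \<theta> [x, y, z]" for x y z
      using D\<kappa>[of x y z] by (simp add: J_derivation_3[of J "J_derivation J \<theta>"] J_derivation_3[of J \<kappa>] D\<theta>)
    from type_part_1_2_J_derivation[of \<theta> J, OF ml(1) J(2) this]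
    show ?thesis
      unfolding us delbar_def one_add_one \<theta>_def[symmetric] \<beta>_def D\<theta> by (simp add: algebra_simps)
  qed
  have d\<beta>: "ext_d br \<beta> us = (\<i>/2) * ext_d br \<kappa> us" if "length us = 4" for us
  proof -
    obtain x y z w where us: "us = [x, y, z, w]" using list_4_cases \<open>length us = 4\<close> by blast
    show ?thesis unfolding \<beta>_def ext_d_add ext_d_mult us dd by simp
  qed
  have del: "del br J 1 2 (delbar br J 1 1 \<omega>) us = ext_d br \<beta> us" if "length us = 4" for us
  proof -
    obtain x y z w where us: "us = [x, y, z, w]" using list_4_cases \<open>length us = 4\<close> by blast
    have "del br J 1 2 (delbar br J 1 1 \<omega>) us = type_part J 2 2 (ext_d br (delbar br J 1 1 \<omega>)) us"
      unfolding del_def one_add_one ..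
    also have "\<dots> = type_part J 2 2 (ext_d br \<beta>) us"
      by (intro type_part_cong ext_d_cong delbar) (simp add: that)
    also have "\<dots> = ext_d br \<beta> us"
      unfolding us
    proof (rule type_part_2_2_eq[OF multilinear_form_ext_d_4[OF \<beta> bilinear] J(2)])
      fix x y z w
      have "J_derivation J (ext_d br \<beta>) [x, y, z, w] = (\<i>/2) * J_derivation J (ext_d br \<kappa>) [x, y, z, w]"
        by (simp add: J_derivation_4 d\<beta> algebra_simps)
      then show "J_derivation J (ext_d br \<beta>) [x, y, z, w] = 0"
        by (simp add: Dd\<kappa> cc)
    qed
    finally show ?thesis .
  qed
  show ?thesis
  proof (cases "length vs = 5")
    case True
    then obtain x y z w u where vs: "vs = [x, y, z, w, u]" using list_5_cases by blast
    have "ext_d br (del br J 1 2 (delbar br J 1 1 \<omega>)) vs = ext_d br (ext_d br \<beta>) vs"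
      by (intro ext_d_cong del) (simp add: True)
    then show ?thesis by (simp add: vs ext_d_ext_d_3[OF \<beta>(1)])
  next
    case False
    have "has_degree 4 (del br J 1 2 (delbar br J 1 1 \<omega>))"
      using has_degree_type_part[of "1 + 1" 2] by (simp add: del_def eval_nat_numeral)
    from has_degree_ext_d[OF this, of br] False show ?thesis
      by (simp add: has_degree_def)
  qed
qed

section \<open>Connections and curvature\<close>

text \<open>\<open>gauduchon\<close> and the Koszul formula both ask for the vector representing a
  functional. \<open>L\<close> expresses \<open>g\<close> through the standard inner product; it is
  injective by definiteness, hence onto.\<close>

lemma riesz_representation:
  fixes g :: "'e::euclidean_space \<Rightarrow> 'e \<Rightarrow> real"
  assumes g: "riemannian_metric g" and l: "linear l"
  shows "\<exists>!W. \<forall>Z. g W Z = l Z"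
proof -
  have bil: "bilinear g" and pos: "\<And>x. x \<noteq> 0 \<Longrightarrow> g x x > 0"
    using g by (auto simp: riemannian_metric_def)
  have nd: "W = 0" if "\<And>Z. g W Z = 0" for W
    using pos[of W] that[of W] by fastforce
  define L where "L W = (\<Sum>b\<in>Basis. g W b *\<^sub>R b)" for W
  have L: "linear L"
    unfolding L_def
    by (auto intro!: linearI simp: bilinear_ladd[OF bil] bilinear_lmul[OF bil] algebra_simps
        sum.distrib scaleR_sum_right)
  have L_inner: "L W \<bullet> b = g W b" if "b \<in> Basis" for W b
    using that by (simp add: L_def inner_sum_left_Basis)
  have ext: "g W = m" if "\<And>b. b \<in> Basis \<Longrightarrow> g W b = m b" "linear m" for W and m :: "'e \<Rightarrow> real"
  proof
    fix Z
    have "linear (g W)" using bil by (auto simp: bilinear_def)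
    then show "g W Z = m Z"
      using that linear_eq_on_span[of "g W" m Basis Z] by simp
  qed
  have "inj L"
  proof (rule linear_injective_0[THEN iffD2, OF L], intro allI impI)
    fix W assume "L W = 0"
    then have "g W b = (\<lambda>x. 0) b" if "b \<in> Basis" for b
      using L_inner[OF that, of W] by simp
    then have "g W = (\<lambda>x. 0)" by (rule ext) (auto intro: linear_zero)
    then show "W = 0" by (intro nd) (simp add: fun_eq_iff)
  qed
  then have "surj L" using L by (rule linear_inj_imp_surj[rotated])
  then obtain W where W: "L W = (\<Sum>b\<in>Basis. l b *\<^sub>R b)" by (metis surjD)
  have "g W b = l b" if "b \<in> Basis" for b
    using L_inner[OF that, of W] that by (simp add: W inner_sum_left_Basis)
  then have "g W = l" using l by (rule ext)
  moreover have "V = W" if "\<forall>Z. g V Z = l Z" for V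
    using nd[of "V - W"] that \<open>g W = l\<close> by (simp add: bilinear_lsub[OF bil])
  ultimately show ?thesis by (intro ex1I[of _ W]) auto
qed

definition trilinear :: "('e::real_vector \<Rightarrow> 'e \<Rightarrow> 'e \<Rightarrow> real) \<Rightarrow> bool" where
  "trilinear l \<longleftrightarrow> (\<forall>y z. linear (\<lambda>x. l x y z)) \<and> (\<forall>x z. linear (\<lambda>y. l x y z)) \<and> (\<forall>x y. linear (l x y))"

lemma bilinear_riesz:
  fixes g :: "'e::euclidean_space \<Rightarrow> 'e \<Rightarrow> real"
  assumes g: "riemannian_metric g" and l: "trilinear l" and B: "\<And>X Y Z. g (B X Y) Z = l X Y Z"
  shows "bilinear B"
proof -
  have bil: "bilinear g" using g by (auto simp: riemannian_metric_def)
  have 1: "linear (\<lambda>x. l x y z)" and 2: "linear (\<lambda>y. l x y z)" and 3: "linear (l x y)" for x y z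
    using l by (auto simp: trilinear_def)
  have eq: "V = W" if "\<And>Z. g V Z = g W Z" for V W
  proof -
    have "\<exists>!V. \<forall>Z. g V Z = g W Z"
      using bil by (intro riesz_representation[OF g]) (auto simp: bilinear_def)
    then show ?thesis using that by metis
  qed
  show ?thesis
    unfolding bilinear_def
    by (intro conjI allI linearI; rule eq; simp add: bilinear_ladd[OF bil] bilinear_lmul[OF bil] B
        linear_add[OF 1] linear_add[OF 2] linear_scale[OF 1] linear_scale[OF 2])
qed

text \<open>The predicate under the definite description in \<open>levi_civita\<close>, named so
  that existence and uniqueness can be stated for it.\<close>

definition levi_civita_connection ::
    "('e::real_vector \<Rightarrow> 'e \<Rightarrow> 'e) \<Rightarrow> ('e \<Rightarrow> 'e \<Rightarrow> real) \<Rightarrow> ('e \<Rightarrow> 'e \<Rightarrow> 'e) \<Rightarrow> bool" where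
  "levi_civita_connection br g D \<longleftrightarrow> bilinear D \<and> (\<forall>X Y. D X Y - D Y X = br X Y) \<and>
     (\<forall>X Y Z. g (D X Y) Z + g Y (D X Z) = 0)"

lemma levi_civita_connection_levi_civita:
  fixes br :: "'e::euclidean_space \<Rightarrow> 'e \<Rightarrow> 'e" and g :: "'e \<Rightarrow> 'e \<Rightarrow> real"
  assumes br: "bilinear br" "\<And>x. br x x = 0" and g: "riemannian_metric g"
  shows "levi_civita_connection br g (levi_civita br g)"
proof -
  have bil: "bilinear g" and sym: "\<And>x y. g x y = g y x" and pos: "\<And>x. x \<noteq> 0 \<Longrightarrow> g x x > 0"
    using g by (auto simp: riemannian_metric_def)
  note g_simps = bilinear_ladd[OF bil] bilinear_radd[OF bil] bilinear_lmul[OF bil] bilinear_rmul[OF bil]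
    bilinear_lsub[OF bil] bilinear_rsub[OF bil] bilinear_lneg[OF bil]
  note br_simps = bilinear_ladd[OF br(1)] bilinear_radd[OF br(1)] bilinear_lmul[OF br(1)]
    bilinear_rmul[OF br(1)]
  have swap: "br x y = - br y x" for x y by (rule bilinear_alternating_swap[OF br])
  have eq: "V = W" if "\<And>Z. g V Z = g W Z" for V W
    using pos[of "V - W"] that[of "V - W"] by (fastforce simp: g_simps)
  \<comment> \<open>Koszul formula; on left-invariant fields its derivative terms vanish.\<close>
  define k where "k X Y Z = (1/2) * (g (br X Y) Z - g (br Y Z) X + g (br Z X) Y)" for X Y Z
  have k: "trilinear k"
    by (auto simp: trilinear_def k_def g_simps br_simps field_simps intro!: linearI)
  define D where "D X Y = (THE W. \<forall>Z. g W Z = k X Y Z)" for X Y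
  have D: "g (D X Y) Z = k X Y Z" for X Y Z
  proof -
    have "\<exists>!W. \<forall>Z. g W Z = k X Y Z"
      by (rule riesz_representation[OF g]) (use k in \<open>auto simp: trilinear_def\<close>)
    from theI'[OF this] show ?thesis by (simp add: D_def)
  qed
  have "bilinear D" by (rule bilinear_riesz[OF g k D])
  moreover have "D X Y - D Y X = br X Y" for X Y
  proof (rule eq)
    fix Z
    show "g (D X Y - D Y X) Z = g (br X Y) Z"
      using swap[of Y X] swap[of X Z] swap[of Z Y]
      by (simp add: g_simps D k_def field_simps)
  qed
  moreover have "g (D X Y) Z + g Y (D X Z) = 0" for X Y Z
    using swap[of Z X] swap[of Y X] swap[of Z Y] by (simp add: sym[of Y] D k_def g_simps field_simps)
  ultimately have "levi_civita_connection br g D"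
    by (simp add: levi_civita_connection_def)
  moreover have "D' = D" if D': "levi_civita_connection br g D'" for D'
  proof (intro ext eq)
    fix X Y Z
    define h where "h X Y Z = g (D' X Y) Z - g (D X Y) Z" for X Y Z
    have s: "h X Y Z = h Y X Z" for X Y Z
    proof -
      have "D' X Y = D' Y X + br X Y" "D X Y = D Y X + br X Y"
        using D' \<open>levi_civita_connection br g D\<close> unfolding levi_civita_connection_def
        by (metis diff_add_cancel add.commute)+
      then show ?thesis by (simp add: h_def g_simps)
    qed
    have a: "h X Y Z = - h X Z Y" for X Y Z
    proof -
      have "g (D' X Y) Z + g Y (D' X Z) = 0" "g (D X Y) Z + g Y (D X Z) = 0"
        using D' \<open>levi_civita_connection br g D\<close> unfolding levi_civita_connection_def by blast+
      then show ?thesis by (simp add: h_def sym[of Y])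
    qed
    \<comment> \<open>The difference of two solutions is symmetric in the first two arguments and
      skew in the last two. Alternating the two transpositions three times each returns to the start
      with the opposite sign.\<close>
    have "h X Y Z = - h X Y Z"
      using a[of X Y Z] s[of X Z Y] a[of Z X Y] s[of Z Y X] a[of Y Z X] s[of Y X Z] by linarith
    then show "g (D' X Y) Z = g (D X Y) Z" by (simp add: h_def)
  qed
  ultimately have "\<exists>!D. levi_civita_connection br g D" by blast
  from theI'[OF this] show ?thesis
    by (simp add: levi_civita_def levi_civita_connection_def)
qed

text \<open>Both correction terms are skew in \<open>Y\<close> and \<open>Z\<close> because d
  \<omega> is alternating, so the connection stays metric for every \<tau>. Bilinearity and
  metricity are all that the trace computation takes from it.\<close>

lemma gauduchon_metric:
  fixes br :: "'e::euclidean_space \<Rightarrow> 'e \<Rightarrow> 'e" and g :: "'e \<Rightarrow> 'e \<Rightarrow> real"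
  assumes br: "bilinear br" "\<And>x. br x x = 0" and g: "riemannian_metric g" and J: "linear J"
    and \<omega>: "alternating_form (fundamental_form J g)" "has_degree 2 (fundamental_form J g)"
  shows "bilinear (gauduchon br J g \<tau>)"
    and "g (gauduchon br J g \<tau> X Y) Z + g Y (gauduchon br J g \<tau> X Z) = 0"
proof -
  have bil: "bilinear g" and sym: "\<And>x y. g x y = g y x"
    using g by (auto simp: riemannian_metric_def)
  define d\<omega> where "d\<omega> = ext_d br (fundamental_form J g)"
  let ?D = "levi_civita br g"
  define l where "l X Y Z = g (?D X Y) Z + (1 - \<tau>) / 4 * d\<omega> [J X, J Y, J Z]
      + (1 + \<tau>) / 4 * (- d\<omega> [J X, Y, Z])" for X Y Z
  have alt: "alternating_form d\<omega>"
    unfolding d\<omega>_def by (rule ext_d_alternating_3[OF \<omega> br])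
  then have lin: "linear (\<lambda>x. d\<omega> (us @ x # xs))" for us xs
    by (simp add: alternating_form_def multilinear_form_def)
  note d\<omega>_simps = linear_add[OF lin[of "[]"], simplified] linear_scale[OF lin[of "[]"], simplified]
    linear_add[OF lin[of "[v]" for v], simplified] linear_scale[OF lin[of "[v]" for v], simplified]
    linear_add[OF lin[of "[v, w]" for v w], simplified] linear_scale[OF lin[of "[v, w]" for v w], simplified]
  have lc: "levi_civita_connection br g ?D"
    by (rule levi_civita_connection_levi_civita[OF br g])
  then have bilD: "bilinear ?D" and comp: "g (?D X Y) Z + g Y (?D X Z) = 0" for X Y Z
    by (auto simp: levi_civita_connection_def)
  note simps = bilinear_ladd[OF bil] bilinear_radd[OF bil] bilinear_lmul[OF bil] bilinear_rmul[OF bil]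
    bilinear_ladd[OF bilD] bilinear_radd[OF bilD] bilinear_lmul[OF bilD] bilinear_rmul[OF bilD]
    linear_add[OF J] linear_scale[OF J] d\<omega>_simps
  have l: "trilinear l"
    by (auto simp: trilinear_def l_def simps algebra_simps add_divide_distrib diff_divide_distrib intro!: linearI)
  have W: "g (gauduchon br J g \<tau> X Y) Z = l X Y Z" for X Y Z
  proof -
    have "\<exists>!W. \<forall>Z. g W Z = l X Y Z"
      by (rule riesz_representation[OF g]) (use l in \<open>auto simp: trilinear_def\<close>)
    from theI'[OF this] show ?thesis
      by (simp add: gauduchon_def l_def d\<omega>_def Let_def)
  qed
  show "bilinear (gauduchon br J g \<tau>)" by (rule bilinear_riesz[OF g l W])
  show "g (gauduchon br J g \<tau> X Y) Z + g Y (gauduchon br J g \<tau> X Z) = 0"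
    using comp[of X Y Z] alternating_form_simps(5)[OF alt, of "J X" "J Z" "J Y" "[]"]
      alternating_form_simps(5)[OF alt, of "J X" Z Y "[]"]
    by (simp add: sym[of Y] W l_def)
qed

section \<open>The trace of the squared curvature\<close>

lemma frame_expansion:
  fixes g :: "'e::euclidean_space \<Rightarrow> 'e \<Rightarrow> real"
  assumes g: "riemannian_metric g" and e: "orthonormal_frame g e"
  shows "v = (\<Sum>k<DIM('e). g v (e k) *\<^sub>R e k)"
proof -
  let ?n = "DIM('e)"
  have bil: "bilinear g" and pos: "\<And>x. x \<noteq> 0 \<Longrightarrow> g x x > 0"
    using g by (auto simp: riemannian_metric_def)
  have lin: "linear (g x)" "linear (\<lambda>x. g x y)" for x y using bil by (auto simp: bilinear_def)
  have on: "g (e i) (e j) = (if i = j then 1 else 0)" if "i < ?n" "j < ?n" for i j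
    using e that by (auto simp: orthonormal_frame_def)
  have sum_on: "(\<Sum>i<?n. c i * g (e i) (e k)) = c k" if k: "k < ?n" for c k
  proof -
    have "(\<Sum>i<?n. c i * g (e i) (e k)) = (\<Sum>i<?n. if i = k then c i else 0)"
      by (rule sum.cong) (auto simp: on k)
    then show ?thesis using k by simp
  qed
  have inj: "inj_on e {..<?n}"
    by (rule inj_onI) (metis lessThan_iff on zero_neq_one)
  have "independent (e ` {..<?n})"
  proof
    assume "dependent (e ` {..<?n})"
    then obtain u w where u: "w \<in> e ` {..<?n}" "u w \<noteq> 0" and 0: "(\<Sum>v\<in>e ` {..<?n}. u v *\<^sub>R v) = 0"
      by (auto simp: dependent_finite)
    then obtain k where k: "k < ?n" "w = e k" by auto
    have "0 = g (\<Sum>i<?n. u (e i) *\<^sub>R e i) (e k)"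
      using 0 bilinear_lzero[OF bil] by (simp add: sum.reindex[OF inj])
    also have "\<dots> = (\<Sum>i<?n. u (e i) * g (e i) (e k))"
      by (simp add: linear_sum[OF lin(2)] linear_scale[OF lin(2)])
    also have "\<dots> = u (e k)"
      using k by (simp add: sum_on)
    finally show False using u k by simp
  qed
  moreover have "card (e ` {..<?n}) = ?n" using inj by (simp add: card_image)
  ultimately have "UNIV \<subseteq> span (e ` {..<?n})"
    by (intro card_ge_dim_independent) auto
  then have span: "span (e ` {..<?n}) = UNIV" by auto
  define w where "w = v - (\<Sum>k<?n. g v (e k) *\<^sub>R e k)"
  have "g w b = 0" if b: "b \<in> e ` {..<?n}" for b
  proof -
    obtain k where k: "k < ?n" "b = e k" using b by auto
    have "(\<Sum>i<?n. g v (e i) * g (e i) (e k)) = g v (e k)"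
      by (rule sum_on[OF k(1)])
    then show ?thesis
      by (simp add: w_def k bilinear_lsub[OF bil] linear_sum[OF lin(2)] linear_scale[OF lin(2)])
  qed
  then have "g w w = 0"
    using linear_eq_0_on_span[OF lin(1), of "e ` {..<?n}" w w] span by auto
  then have "w = 0" using pos[of w] by fastforce
  then show ?thesis by (simp add: w_def)
qed

lemma sum_square_symmetric:
  fixes f :: "nat \<Rightarrow> nat \<Rightarrow> real"
  assumes "\<And>i j. f i j = f j i" "\<And>i. f i i = 0"
  shows "(\<Sum>j<n. \<Sum>i<n. f i j) = 2 * (\<Sum>j<n. \<Sum>i<j. f i j)"
proof (induction n)
  case (Suc n)
  have "(\<Sum>j<n. f n j) = (\<Sum>j<n. f j n)" by (rule sum.cong[OF refl assms(1)])
  with Suc show ?case by (simp add: sum.distrib assms(2))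
qed simp

text \<open>The trace of A* B, with the adjoint taken for \<open>g\<close>; on skew maps it is the
  trace form up to sign.\<close>

definition frame_product :: "('e::euclidean_space \<Rightarrow> 'e \<Rightarrow> real) \<Rightarrow> (nat \<Rightarrow> 'e) \<Rightarrow> ('e \<Rightarrow> 'e) \<Rightarrow> ('e \<Rightarrow> 'e) \<Rightarrow> real" where
  "frame_product g e A B = (\<Sum>j<DIM('e). g (A (e j)) (B (e j)))"

definition skew :: "('e::real_vector \<Rightarrow> 'e \<Rightarrow> real) \<Rightarrow> ('e \<Rightarrow> 'e) \<Rightarrow> bool" where
  "skew g A \<longleftrightarrow> linear A \<and> (\<forall>x y. g (A x) y = - g x (A y))"

lemma frame_product_skew:
  fixes g :: "'e::euclidean_space \<Rightarrow> 'e \<Rightarrow> real"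
  assumes g: "riemannian_metric g" and e: "orthonormal_frame g e" and A: "skew g A" and B: "skew g B"
  shows "frame_product g e A B = 2 * (\<Sum>j<DIM('e). \<Sum>i<j. g (A (e j)) (e i) * g (B (e j)) (e i))"
proof -
  have bil: "bilinear g" and sym: "\<And>x y. g x y = g y x"
    using g by (auto simp: riemannian_metric_def)
  have lin: "linear (g x)" for x using bil by (auto simp: bilinear_def)
  have A': "g (A x) y = - g (A y) x" for x y using A unfolding skew_def by (metis sym)
  have B': "g (B x) y = - g (B y) x" for x y using B unfolding skew_def by (metis sym)
  have "g (A (e j)) (B (e j)) = (\<Sum>i<DIM('e). g (A (e j)) (e i) * g (B (e j)) (e i))" for j
    by (subst frame_expansion[OF g e, of "B (e j)"])
      (simp add: linear_sum[OF lin] linear_scale[OF lin] mult.commute)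
  then have "frame_product g e A B = (\<Sum>j<DIM('e). \<Sum>i<DIM('e). g (A (e j)) (e i) * g (B (e j)) (e i))"
    by (simp add: frame_product_def)
  also have "\<dots> = 2 * (\<Sum>j<DIM('e). \<Sum>i<j. g (A (e j)) (e i) * g (B (e j)) (e i))"
  proof (rule sum_square_symmetric)
    show "g (A (e j)) (e i) * g (B (e j)) (e i) = g (A (e i)) (e j) * g (B (e i)) (e j)" for i j
      by (simp add: A'[of "e j"] B'[of "e j"])
    show "g (A (e i)) (e i) * g (B (e i)) (e i) = 0" for i
      using A'[of "e i" "e i"] by simp
  qed
  finally show ?thesis .
qed

text \<open>\<open>C\<close> composed on the left moves across by skewness. Composed on the right,
  it moves after expanding \<open>C (e j)\<close> in the frame and exchanging the two summation
  indices.\<close>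

lemma frame_product_invariant:
  fixes g :: "'e::euclidean_space \<Rightarrow> 'e \<Rightarrow> real"
  assumes g: "riemannian_metric g" and e: "orthonormal_frame g e"
    and C: "skew g C" and A: "linear A" and B: "linear B"
  shows "frame_product g e (\<lambda>v. C (A v) - A (C v)) B = - frame_product g e A (\<lambda>v. C (B v) - B (C v))"
proof -
  let ?n = "DIM('e)"
  have bil: "bilinear g" and sym: "\<And>x y. g x y = g y x"
    using g by (auto simp: riemannian_metric_def)
  have lin: "linear (g x)" "linear (\<lambda>x. g x y)" for x y using bil by (auto simp: bilinear_def)
  have C': "g (C x) y = - g x (C y)" for x y using C by (simp add: skew_def)
  have AC: "(\<Sum>j<?n. g (A (C (e j))) (B (e j))) = (\<Sum>j<?n. \<Sum>k<?n. g (C (e j)) (e k) * g (A (e k)) (B (e j)))"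
    by (subst frame_expansion[OF g e, of "C _"])
      (simp add: linear_sum[OF A] linear_scale[OF A] linear_sum[OF lin(2)] linear_scale[OF lin(2)])
  have "(\<Sum>j<?n. g (A (e j)) (B (C (e j)))) = (\<Sum>j<?n. \<Sum>k<?n. g (C (e j)) (e k) * g (A (e j)) (B (e k)))"
    by (subst frame_expansion[OF g e, of "C _"])
      (simp add: linear_sum[OF B] linear_scale[OF B] linear_sum[OF lin(1)] linear_scale[OF lin(1)])
  also have "\<dots> = (\<Sum>j<?n. \<Sum>k<?n. g (C (e k)) (e j) * g (A (e k)) (B (e j)))"
    by (rule sum.swap)
  also have "\<dots> = - (\<Sum>j<?n. g (A (C (e j))) (B (e j)))"
    unfolding AC sum_negf[symmetric]
    by (intro sum.cong refl) (metis C' sym mult_minus_left)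
  finally have "(\<Sum>j<?n. g (A (e j)) (B (C (e j)))) = - (\<Sum>j<?n. g (A (C (e j))) (B (e j)))" .
  then show ?thesis
    by (simp add: frame_product_def bilinear_lsub[OF bil] bilinear_rsub[OF bil] sum_subtractf C' sum_negf)
qed

lemma wedge_2_2:
  assumes "has_degree 2 \<alpha>" "has_degree 2 \<beta>"
  shows "(\<alpha> \<and>\<^sub>w \<beta>) [x, y, z, w] = \<alpha> [x, y] * \<beta> [z, w] - \<alpha> [x, z] * \<beta> [y, w] + \<alpha> [x, w] * \<beta> [y, z]
    + \<alpha> [y, z] * \<beta> [x, w] - \<alpha> [y, w] * \<beta> [x, z] + \<alpha> [z, w] * \<beta> [x, y]"
proof -
  have 0: "\<alpha> [] = 0" "\<alpha> [a] = 0" "\<alpha> [a, b, c] = 0" "\<alpha> [a, b, c, d] = 0"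
    "\<beta> [] = 0" "\<beta> [a] = 0" "\<beta> [a, b, c] = 0" "\<beta> [a, b, c, d] = 0" for a b c d
    using assms unfolding has_degree_def by simp_all
  show ?thesis
    by (simp only: wedge_Cons wedge_Nil list.size) (simp add: 0)
qed

context lie_algebra begin

text \<open>The second Bianchi identity, solved for one curvature term so that it can rewrite.
  Because it is phrased with brackets, it also holds for connections with torsion.\<close>

lemma bianchi:
  assumes D: "bilinear D"
  shows "curvature br D (br y z) x v = curvature br D (br x z) y v - curvature br D (br x y) z v
    + (D x (curvature br D y z v) - curvature br D y z (D x v))
    - (D y (curvature br D x z v) - curvature br D x z (D y v))
    + (D z (curvature br D x y v) - curvature br D x y (D z v))"
proof -
  note D_simps = bilinear_radd[OF D] bilinear_rsub[OF D] bilinear_lneg[OF D]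
  have "D (br (br y z) x) v = D (br (br x z) y) v - D (br (br x y) z) v"
    by (simp only: jacobi_right[of y z x] bilinear_lsub[OF D])
  then show ?thesis
    by (simp add: curvature_def D_simps algebra_simps)
qed

lemma skew_curvature:
  assumes g: "riemannian_metric g" and D: "bilinear D" "\<And>X Y Z. g (D X Y) Z + g Y (D X Z) = 0"
  shows "skew g (curvature br D X Y)"
proof -
  have bil: "bilinear g" using g by (auto simp: riemannian_metric_def)
  have D': "g (D X Y) Z = - g Y (D X Z)" for X Y Z using D(2)[of X Y Z] by simp
  show ?thesis
    unfolding skew_def
    by (auto intro!: linearI simp: curvature_def bilinear_radd[OF D(1)] bilinear_rmul[OF D(1)]
        bilinear_lsub[OF bil] bilinear_rsub[OF bil]
        bilinear_ladd[OF bil] bilinear_radd[OF bil] D' algebra_simps)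
qed

end

text \<open>Let \<open>Q\<close> be the invariant form \<open>-tr(AB)\<close> on skew endomorphisms. The exterior derivative is a signed
  sum over splittings of the five arguments into \<open>x, y, z\<close> and \<open>u, w\<close> of the cyclic sums of
  \<open>Q(R([x, y], z), R(u, w))\<close>. By the Bianchi identity these are the cyclic sums of
  \<open>Q([D\<^sub>x, R(y, z)], R(u, w))\<close>, and the terms for \<open>(x; y, z; u, w)\<close> and \<open>(x; u, w; y, z)\<close> cancel by
  the invariance of \<open>Q\<close>.\<close>

lemma ext_d_trace_curvature_sq:
  fixes br :: "'e::euclidean_space \<Rightarrow> 'e \<Rightarrow> 'e" and g :: "'e \<Rightarrow> 'e \<Rightarrow> real"
  assumes "lie_algebra br"
  assumes g: "riemannian_metric g" and e: "orthonormal_frame g e"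
    and D: "bilinear D" "\<And>X Y Z. g (D X Y) Z + g Y (D X Z) = 0"
  shows "ext_d br (trace_curvature_sq br g D e) vs = 0"
proof -
  interpret lie_algebra br by fact
  have bil: "bilinear g" and sym: "\<And>x y. g x y = g y x"
    using g by (auto simp: riemannian_metric_def)
  let ?R = "curvature br D"
  let ?\<Omega> = "curvature_form br g D e"
  let ?\<eta> = "trace_curvature_sq br g D e"
  define Q where "Q = frame_product g e"
  define N where "N x y z = (\<lambda>v. D x (?R y z v) - ?R y z (D x v))" for x y z
  have \<Omega>: "has_degree 2 (?\<Omega> i j)" for i j
    by (auto simp: has_degree_def curvature_form_def split: list.split)
  have skR: "skew g (?R x y)" for x y by (rule skew_curvature[where g = g and D = D, OF g D])
  then have linR: "linear (?R x y)" for x y unfolding skew_def by blast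
  have skD: "skew g (D x)" for x
    unfolding skew_def using D(1) D(2)[of x] by (simp add: bilinear_def eq_neg_iff_add_eq_0)
  \<comment> \<open>The factors 2 agree: squaring a 2-form counts each splitting into pairs twice,
    and \<open>frame_product\<close> is twice the sum over i < j.\<close>
  have \<eta>: "?\<eta> [x, y, z, w] = Q (?R x y) (?R z w) - Q (?R x z) (?R y w) + Q (?R x w) (?R y z)" for x y z w
    unfolding Q_def frame_product_skew[OF g e skR skR]
    by (simp add: trace_curvature_sq_def wedge_2_2[OF \<Omega> \<Omega>] curvature_form_def
        sum.distrib sum_subtractf sum_distrib_left algebra_simps)
  have Q_sym: "Q A B = Q B A" for A B
    by (simp add: Q_def frame_product_def sym)
  have N: "Q (N x y z) (?R u w) = - Q (N x u w) (?R y z)" for x y z u w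
  proof -
    have "Q (N x y z) (?R u w) = - Q (?R y z) (N x u w)"
      unfolding Q_def N_def by (rule frame_product_invariant[OF g e skD linR linR])
    then show ?thesis by (simp only: Q_sym[of "?R y z"])
  qed
  have bi: "?R (br y z) x v = ?R (br x z) y v - ?R (br x y) z v + N x y z v - N y x z v + N z x y v" for x y z v
    unfolding N_def by (rule bianchi[OF D(1)])
  have B: "Q (?R (br y z) x) S = Q (?R (br x z) y) S - Q (?R (br x y) z) S
      + Q (N x y z) S - Q (N y x z) S + Q (N z x y) S" for x y z S
    unfolding Q_def frame_product_def
    by (simp add: bi[of y z x] bilinear_ladd[OF bil] bilinear_lsub[OF bil] sum.distrib sum_subtractf)
  have \<eta>_deg: "has_degree 4 ?\<eta>"
    using has_degree_wedge[OF \<Omega> \<Omega>] by (simp add: has_degree_def trace_curvature_sq_def)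
  show ?thesis
  proof (cases "length vs = 5")
    case True
    then obtain a b c d f where vs: "vs = [a, b, c, d, f]"
      by (auto simp: length_Suc_conv eval_nat_numeral)
    \<comment> \<open>The ten instances of \<open>B\<close> belong to the triples of arguments, the
      other two filling \<open>S\<close>. The fifteen instances of \<open>N\<close> combine five
      choices of the direction of \<open>D\<close> with three splittings of the remaining arguments
      into pairs.\<close>
    show ?thesis
      unfolding vs ext_d_5 \<eta>
        B[where x = a and y = b and z = c and S = "?R d f"] B[where x = a and y = b and z = d and S = "?R c f"]
        B[where x = a and y = b and z = f and S = "?R c d"] B[where x = a and y = c and z = d and S = "?R b f"]
        B[where x = a and y = c and z = f and S = "?R b d"] B[where x = a and y = d and z = f and S = "?R b c"]
        B[where x = b and y = c and z = d and S = "?R a f"] B[where x = b and y = c and z = f and S = "?R a d"]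
        B[where x = b and y = d and z = f and S = "?R a c"] B[where x = c and y = d and z = f and S = "?R a b"]
        N[of a b c d f] N[of a b d c f] N[of a b f c d]
        N[of b a c d f] N[of b a d c f] N[of b a f c d]
        N[of c a b d f] N[of c a d b f] N[of c a f b d]
        N[of d a b c f] N[of d a c b f] N[of d a f b c]
        N[of f a b c d] N[of f a c b d] N[of f a d b c]
      by simp
  next
    case False
    then show ?thesis using has_degree_ext_d[OF \<eta>_deg, of br] by (simp add: has_degree_def)
  qed
qed

section \<open>The norm of a holomorphic volume form\<close>

text \<open>One step of Gram-Schmidt for \<open>g\<close>, reduced through \<open>L\<close> to
  orthogonality for the standard inner product.\<close>

lemma exists_unit_orthogonal:
  fixes g :: "'e::euclidean_space \<Rightarrow> 'e \<Rightarrow> real"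
  assumes g: "riemannian_metric g" and S: "finite S" "card S < DIM('e)"
  shows "\<exists>x. g x x = 1 \<and> (\<forall>s\<in>S. g x s = 0)"
proof -
  have bil: "bilinear g" and pos: "\<And>x. x \<noteq> 0 \<Longrightarrow> g x x > 0"
    using g by (auto simp: riemannian_metric_def)
  have lin: "linear (\<lambda>x. g x y)" for y using bil by (auto simp: bilinear_def)
  define L where "L s = (\<Sum>b\<in>Basis. g b s *\<^sub>R b)" for s
  have L: "g x s = x \<bullet> L s" for x s
  proof -
    have "g x s = g (\<Sum>b\<in>Basis. (x \<bullet> b) *\<^sub>R b) s" by (simp add: euclidean_representation)
    also have "\<dots> = (\<Sum>b\<in>Basis. (x \<bullet> b) * g b s)"
      by (simp only: linear_sum[OF lin] linear_scale[OF lin]) simp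
    finally show ?thesis by (simp add: L_def inner_sum_right mult.commute)
  qed
  have "dim (L ` S) \<le> card (L ` S)" using S(1) by (intro dim_le_card') auto
  also have "\<dots> \<le> card S" by (rule card_image_le[OF S(1)])
  finally have "dim (L ` S) < DIM('e)" using S(2) by simp
  then obtain x where x: "x \<noteq> 0" "\<And>y. y \<in> span (L ` S) \<Longrightarrow> orthogonal x y"
    using orthogonal_to_subspace_exists by blast
  have 0: "g x s = 0" if "s \<in> S" for s
    using x(2)[of "L s"] that by (simp add: L orthogonal_def span_base)
  have "g (x /\<^sub>R sqrt (g x x)) (x /\<^sub>R sqrt (g x x)) = 1"
    using pos[OF x(1)] by (simp add: bilinear_lmul[OF bil] bilinear_rmul[OF bil] divide_simps)
  moreover have "\<forall>s\<in>S. g (x /\<^sub>R sqrt (g x x)) s = 0"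
    using 0 by (simp add: bilinear_lmul[OF bil])
  ultimately show ?thesis by blast
qed

lemma hermitian_metric_J:
  assumes "hermitian_metric J g" "linear J" "\<And>x. J (J x) = - x"
  shows "g (J x) y = - g x (J y)" and "g (J x) x = 0"
proof -
  have g: "bilinear g" "\<And>x y. g x y = g y x" "\<And>x y. g (J x) (J y) = g x y"
    using assms(1) by (auto simp: hermitian_metric_def riemannian_metric_def)
  have 1: "g (J x) y = - g x (J y)" for x y
    using g(3)[of x "J y"] by (simp add: assms(3) bilinear_rneg[OF g(1)])
  show "g (J x) y = - g x (J y)" by (rule 1)
  show "g (J x) x = 0" using 1[of x x] g(2)[of x "J x"] by simp
qed

lemma unitary_frame:
  fixes g :: "'e::euclidean_space \<Rightarrow> 'e \<Rightarrow> real"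
  assumes dim: "DIM('e) = 6" and h: "hermitian_metric J g" and J: "linear J" "\<And>x. J (J x) = - x"
  shows "\<exists>a b c. g a a = 1 \<and> g b b = 1 \<and> g c c = 1 \<and> g a b = 0 \<and> g a c = 0 \<and> g b c = 0 \<and>
    g (J a) b = 0 \<and> g (J a) c = 0 \<and> g (J b) c = 0 \<and> span {a, J a, b, J b, c, J c} = UNIV"
proof -
  have g: "riemannian_metric g" and bil: "bilinear g" and sym: "\<And>x y. g x y = g y x"
    and inv: "\<And>x y. g (J x) (J y) = g x y"
    using h by (auto simp: hermitian_metric_def riemannian_metric_def)
  note gJ = hermitian_metric_J[OF h J]
  obtain a where a: "g a a = 1" using exists_unit_orthogonal[OF g, of "{}"] by auto
  \<comment> \<open>The length of a list bounds the cardinality without a proof that its entries are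
    distinct.\<close>
  have "card {a, J a} < DIM('e)"
    using dim card_length[of "[a, J a]"] by simp
  then obtain b where b: "g b b = 1" "g b a = 0" "g b (J a) = 0"
    using exists_unit_orthogonal[OF g, of "{a, J a}"] by auto
  have "card {a, J a, b, J b} < DIM('e)"
    using dim card_length[of "[a, J a, b, J b]"] by simp
  then obtain c where c: "g c c = 1" "g c a = 0" "g c (J a) = 0" "g c b = 0" "g c (J b) = 0"
    using exists_unit_orthogonal[OF g, of "{a, J a, b, J b}"] by auto
  have ab: "g a b = 0" "g (J a) b = 0" "g a c = 0" "g (J a) c = 0" "g b c = 0" "g (J b) c = 0"
    using b c sym by metis+
  have ba: "g (J b) a = 0" "g (J c) a = 0" "g (J c) b = 0"
    using b c by (simp_all add: gJ(1))
  have gJ_right: "g x (J y) = - g (J x) y" for x y by (simp add: gJ(1))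
  define e where "e i = [a, J a, b, J b, c, J c] ! i" for i
  have "orthonormal_frame g e"
    unfolding orthonormal_frame_def dim e_def
    by (simp add: All_less_Suc eval_nat_numeral a b c ab ba gJ_right gJ(2) J(2)
        bilinear_lneg[OF bil])
  then have "v \<in> span {a, J a, b, J b, c, J c}" for v
    by (subst frame_expansion[OF g, of e])
      (auto simp: dim e_def eval_nat_numeral intro!: span_add span_scale intro: span_base)
  then have "span {a, J a, b, J b, c, J c} = UNIV" by auto
  then show ?thesis using a b c ab by blast
qed

lemma wedge_2_4:
  assumes "has_degree 2 \<alpha>" "has_degree 4 \<beta>"
  shows "(\<alpha> \<and>\<^sub>w \<beta>) [x, y, z, u, v, w] =
      \<alpha> [x, y] * \<beta> [z, u, v, w] - \<alpha> [x, z] * \<beta> [y, u, v, w] + \<alpha> [x, u] * \<beta> [y, z, v, w]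
    - \<alpha> [x, v] * \<beta> [y, z, u, w] + \<alpha> [x, w] * \<beta> [y, z, u, v] + \<alpha> [y, z] * \<beta> [x, u, v, w]
    - \<alpha> [y, u] * \<beta> [x, z, v, w] + \<alpha> [y, v] * \<beta> [x, z, u, w] - \<alpha> [y, w] * \<beta> [x, z, u, v]
    + \<alpha> [z, u] * \<beta> [x, y, v, w] - \<alpha> [z, v] * \<beta> [x, y, u, w] + \<alpha> [z, w] * \<beta> [x, y, u, v]
    + \<alpha> [u, v] * \<beta> [x, y, z, w] - \<alpha> [u, w] * \<beta> [x, y, z, v] + \<alpha> [v, w] * \<beta> [x, y, z, u]"
proof -
  have 0: "\<alpha> [] = 0" "\<alpha> [a] = 0" "\<alpha> (a # b # c # xs) = 0" for a b c xs
    using assms unfolding has_degree_def by simp_all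
  show ?thesis
    by (simp only: wedge_Cons wedge_Nil list.size 0 mult_zero_left mult_zero_right wedge_zero_left) simp
qed

lemma wedge_3_3:
  assumes "has_degree 3 \<alpha>" "has_degree 3 \<beta>"
  shows "(\<alpha> \<and>\<^sub>w \<beta>) [x, y, z, u, v, w] =
      \<alpha> [x, y, z] * \<beta> [u, v, w] - \<alpha> [x, y, u] * \<beta> [z, v, w] + \<alpha> [x, y, v] * \<beta> [z, u, w]
    - \<alpha> [x, y, w] * \<beta> [z, u, v] + \<alpha> [x, z, u] * \<beta> [y, v, w] - \<alpha> [x, z, v] * \<beta> [y, u, w]
    + \<alpha> [x, z, w] * \<beta> [y, u, v] + \<alpha> [x, u, v] * \<beta> [y, z, w] - \<alpha> [x, u, w] * \<beta> [y, z, v]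
    + \<alpha> [x, v, w] * \<beta> [y, z, u] - \<alpha> [y, z, u] * \<beta> [x, v, w] + \<alpha> [y, z, v] * \<beta> [x, u, w]
    - \<alpha> [y, z, w] * \<beta> [x, u, v] - \<alpha> [y, u, v] * \<beta> [x, z, w] + \<alpha> [y, u, w] * \<beta> [x, z, v]
    - \<alpha> [y, v, w] * \<beta> [x, z, u] + \<alpha> [z, u, v] * \<beta> [x, y, w] - \<alpha> [z, u, w] * \<beta> [x, y, v]
    + \<alpha> [z, v, w] * \<beta> [x, y, u] - \<alpha> [u, v, w] * \<beta> [x, y, z]"
proof -
  have 0: "\<alpha> [] = 0" "\<alpha> [a] = 0" "\<alpha> [a, b] = 0" "\<alpha> (a # b # c # d # xs) = 0" for a b c d xs
    using assms unfolding has_degree_def by simp_all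
  show ?thesis
    by (simp only: wedge_Cons wedge_Nil list.size 0 mult_zero_left mult_zero_right wedge_zero_left) simp
qed

lemma alternating_form_cnj:
  assumes "alternating_form \<Psi>"
  shows "alternating_form (\<lambda>xs. cnj (\<Psi> xs))"
proof -
  have lin: "linear (\<lambda>x. \<Psi> (us @ x # xs))" for us xs
    using assms by (simp add: alternating_form_def multilinear_form_def)
  show ?thesis
    using assms linear_add[OF lin] linear_scale[OF lin]
    by (auto simp: alternating_form_def multilinear_form_def intro!: linearI)
qed

lemma alternating_form_of_real:
  fixes \<alpha> :: "('e::real_vector, real) form"
  assumes "alternating_form \<alpha>"
  shows "alternating_form (\<lambda>xs. complex_of_real (\<alpha> xs))"
proof -
  have lin: "linear (\<lambda>x. \<alpha> (us @ x # xs))" for us xs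
    using assms by (simp add: alternating_form_def multilinear_form_def)
  show ?thesis
    using assms linear_add[OF lin] linear_scale[OF lin]
    by (auto simp: alternating_form_def multilinear_form_def scaleR_conv_of_real intro!: linearI)
qed

lemma fundamental_form_alternating:
  assumes h: "hermitian_metric J g" and J: "linear J" "\<And>x. J (J x) = - x"
  shows "alternating_form (fundamental_form J g)" "has_degree 2 (fundamental_form J g)"
proof -
  have bil: "bilinear g" using h by (auto simp: hermitian_metric_def riemannian_metric_def)
  show deg: "has_degree 2 (fundamental_form J g)"
    by (auto simp: has_degree_def fundamental_form_def split: list.split)
  have "linear (\<lambda>x. fundamental_form J g (us @ x # xs))" for us xs
  proof (cases "length us + length xs = 1")
    case True
    then have "length us = 0 \<and> length xs = 1 \<or> length us = 1 \<and> length xs = 0" by arith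
    then consider y where "us = []" "xs = [y]" | y where "us = [y]" "xs = []"
      by (auto simp: length_Suc_conv)
    then show ?thesis
      by cases (auto simp: fundamental_form_def bilinear_ladd[OF bil] bilinear_radd[OF bil]
          bilinear_lmul[OF bil] bilinear_rmul[OF bil] linear_add[OF J(1)] linear_scale[OF J(1)]
          intro!: linearI)
  next
    case False
    then have "(\<lambda>x. fundamental_form J g (us @ x # xs)) = (\<lambda>x. 0)"
      using deg by (auto simp: has_degree_def)
    then show ?thesis by (simp add: linear_zero)
  qed
  moreover have "fundamental_form J g (us @ x # x # xs) = 0" for us x xs
  proof (cases "us = [] \<and> xs = []")
    case True
    then show ?thesis using hermitian_metric_J(2)[OF h J, of x] by (simp add: fundamental_form_def)
  next
    case False
    then show ?thesis using deg by (auto simp: has_degree_def)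
  qed
  ultimately show "alternating_form (fundamental_form J g)"
    by (simp add: alternating_form_def multilinear_form_def)
qed

text \<open>\<open>J\<close> acts as i on the vectors \<open>vec10 J x\<close>. Concretely, the
  expanded projection is substituted on both sides and the terms match.\<close>

lemma type_3_0_J:
  assumes "is_type_form J 3 0 \<Psi>" "\<And>x. J (J x) = - x"
  shows "\<Psi> [J x, y, z] = \<i> * \<Psi> [x, y, z]" "\<Psi> [x, J y, z] = \<i> * \<Psi> [x, y, z]"
    "\<Psi> [x, y, J z] = \<i> * \<Psi> [x, y, z]"
proof -
  have form: "is_form 3 \<Psi>" and type: "type_part J 3 0 \<Psi> = \<Psi>"
    using assms(1) by (auto simp: is_type_form_def)
  have ml: "multilinear_form \<Psi>"
    using is_form_alternating(1)[OF form] by (simp add: alternating_form_def)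
  note neg = multilinear_neg_neg_simps[OF ml, of J, OF assms(2)]
  have "type_part J 3 0 \<Psi> [x, y, z] = (1/8) *
    (\<Psi> [x, y, z] - \<i> * (\<Psi> [J x, y, z] + \<Psi> [x, J y, z] + \<Psi> [x, y, J z])
     - (\<Psi> [J x, J y, z] + \<Psi> [J x, y, J z] + \<Psi> [x, J y, J z]) + \<i> * \<Psi> [J x, J y, J z])" for x y z
    by (simp add: type_part_def sum_subsets_card numeral_3_eq_3 sum_Pow_lessThan_Suc
        card_insert_if upt_rec vec10_def vec01_def multilinear_form_half_simps[OF ml]
        scaleR_conv_of_real algebra_simps)
  then have eq: "\<Psi> [x, y, z] = (1/8) *
    (\<Psi> [x, y, z] - \<i> * (\<Psi> [J x, y, z] + \<Psi> [x, J y, z] + \<Psi> [x, y, J z])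
     - (\<Psi> [J x, J y, z] + \<Psi> [J x, y, J z] + \<Psi> [x, J y, J z]) + \<i> * \<Psi> [J x, J y, J z])" for x y z
    by (simp only: type)
  show "\<Psi> [J x, y, z] = \<i> * \<Psi> [x, y, z]"
    by (subst (1 2) eq) (simp add: neg algebra_simps)
  show "\<Psi> [x, J y, z] = \<i> * \<Psi> [x, y, z]"
    by (subst (1 2) eq) (simp add: neg algebra_simps)
  show "\<Psi> [x, y, J z] = \<i> * \<Psi> [x, y, z]"
    by (subst (1 2) eq) (simp add: neg algebra_simps)
qed

text \<open>Each \<open>J\<close> comes out as a factor i, so a value on the real frame reduces to
  one on \<open>a\<close>, \<open>b\<close>, \<open>c\<close>, which is zero or plus or minus
  \<open>\<Psi> [a, b, c]\<close>.\<close>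

lemma type_3_0_eq_0:
  assumes \<Psi>: "is_type_form J 3 0 \<Psi>" and J: "\<And>x. J (J x) = - x"
    and span: "span {a, J a, b, J b, c, J c} = UNIV" and 0: "\<Psi> [a, b, c] = 0"
  shows "\<Psi> vs = 0"
proof -
  have alt: "alternating_form \<Psi>" and deg: "has_degree 3 \<Psi>"
    using \<Psi> is_form_alternating[of 3 \<Psi>] by (auto simp: is_type_form_def)
  note \<Psi>J = type_3_0_J[OF \<Psi> J]
  have 1: "\<Psi> ws = 0" if "length ws = 3" "set ws \<subseteq> {a, b, c}" for ws
  proof (cases "distinct ws")
    case True
    obtain x y z where ws: "ws = [x, y, z]"
      using list_3_cases \<open>length ws = 3\<close> by blast
    have "mset ws = mset [a, b, c]"
      using that True by (auto simp: ws add_mset_commute)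
    from alternating_form_perm[OF alt this, of "[]"] show ?thesis by (auto simp: 0)
  next
    case False
    then show ?thesis by (rule alternating_form_not_distinct[OF alt])
  qed
  have "\<Psi> ws = 0" if len: "length ws = 3" and ws: "set ws \<subseteq> {a, J a, b, J b, c, J c}" for ws
  proof -
    obtain x y z where xyz: "ws = [x, y, z]"
      using list_3_cases len by blast
    have "\<exists>x'\<in>{a, b, c}. x = x' \<or> x = J x'" "\<exists>y'\<in>{a, b, c}. y = y' \<or> y = J y'"
      "\<exists>z'\<in>{a, b, c}. z = z' \<or> z = J z'"
      using ws by (auto simp: xyz)
    then obtain x' y' z' where "x' \<in> {a, b, c}" "y' \<in> {a, b, c}" "z' \<in> {a, b, c}"
      and *: "x = x' \<or> x = J x'" "y = y' \<or> y = J y'" "z = z' \<or> z = J z'" by blast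
    then have "\<Psi> [x', y', z'] = 0" by (intro 1) auto
    with * show ?thesis by (auto simp: xyz \<Psi>J)
  qed
  then show ?thesis
    using multilinear_form_eq_0_on_span[OF _ span, of \<Psi> 3 vs] alt deg
    by (cases "length vs = 3") (auto simp: alternating_form_def has_degree_def)
qed

text \<open>Both sides of the equation defining the norm are top-degree forms, so one evaluation on
  a unitary frame determines their ratio \<open>k\<close>. It is positive because a nonzero
  (3,0)-form cannot vanish on \<open>a\<close>, \<open>b\<close>, \<open>c\<close>.\<close>

lemma volume_form_norm:
  fixes g :: "'e::euclidean_space \<Rightarrow> 'e \<Rightarrow> real" and \<Psi> :: "('e, complex) form"
  assumes dim: "DIM('e) = 6" and h: "hermitian_metric J g" and J: "linear J" "\<And>x. J (J x) = - x"
    and \<Psi>: "is_type_form J 3 0 \<Psi>" "\<exists>vs. \<Psi> vs \<noteq> 0"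
  shows "norm_wrt \<Psi> (fundamental_form J g) > 0"
proof -
  let ?\<omega> = "fundamental_form J g"
  let ?F = "\<lambda>vs. \<i> * (\<Psi> \<and>\<^sub>w (\<lambda>xs. cnj (\<Psi> xs))) vs" and ?G = "?\<omega> \<and>\<^sub>w ?\<omega> \<and>\<^sub>w ?\<omega>"
  obtain a b c where abc: "g a a = 1" "g b b = 1" "g c c = 1" "g a b = 0" "g a c = 0" "g b c = 0"
      "g (J a) b = 0" "g (J a) c = 0" "g (J b) c = 0"
    and span: "span {a, J a, b, J b, c, J c} = UNIV"
    using unitary_frame[OF dim h J] by blast
  have bil: "bilinear g" and sym: "\<And>x y. g x y = g y x" and inv: "\<And>x y. g (J x) (J y) = g x y"
    using h by (auto simp: hermitian_metric_def riemannian_metric_def)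
  have alt: "alternating_form \<Psi>" and deg: "has_degree 3 \<Psi>"
    using \<Psi>(1) is_form_alternating[of 3 \<Psi>] by (auto simp: is_type_form_def)
  note \<omega> = fundamental_form_alternating[OF h J]
  have deg': "has_degree 3 (\<lambda>xs. cnj (\<Psi> xs))" using deg by (simp add: has_degree_def)
  have deg4: "has_degree 4 (?\<omega> \<and>\<^sub>w ?\<omega>)" using has_degree_wedge[OF \<omega>(2) \<omega>(2)] by simp
  let ?bs = "[a, J a, b, J b, c, J c]"
  have gJ: "g x (J y) = - g (J x) y" "g (J x) x = 0" for x y
    using hermitian_metric_J[OF h J, of x] by auto
  have \<omega>_eq: "?\<omega> [x, y] = g (J x) y" for x y by (simp add: fundamental_form_def)
  \<comment> \<open>Only the pairs (x, J x) contribute, each with value 1, in 3! orders.\<close>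
  have G: "?G ?bs = 6"
    by (simp add: wedge_2_4[OF \<omega>(2) deg4] wedge_2_2[OF \<omega>(2) \<omega>(2)] \<omega>_eq gJ inv abc J
        bilinear_lneg[OF bil])
  define p where "p = \<Psi> [a, b, c]"
  have "p \<noteq> 0"
    using type_3_0_eq_0[OF \<Psi>(1) J(2) span] \<Psi>(2) by (auto simp: p_def)
  \<comment> \<open>\<open>\<Psi>\<close> must receive one vector from each pair (x, J x); each of
    the eight choices contributes \<open>(cmod p)\<^sup>2\<close>.\<close>
  have F: "?F ?bs = complex_of_real (8 * (cmod p)\<^sup>2)"
    by (simp add: wedge_3_3[OF deg deg'] type_3_0_J[OF \<Psi>(1) J(2)] alternating_form_simps(2-4)[OF alt]
        p_def[symmetric] complex_norm_square[symmetric, simplified] algebra_simps)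
  define k where "k = (8 * (cmod p)\<^sup>2) / 6"
  have "k > 0" using \<open>p \<noteq> 0\<close> by (simp add: k_def)
  have F_alt: "alternating_form ?F"
    using alternating_form_linear_combination[OF alternating_form_wedge[OF alt alternating_form_cnj[OF alt]]
        alternating_form_wedge[OF alt alternating_form_cnj[OF alt]], of \<i> 0] by simp
  have G_alt: "alternating_form (\<lambda>vs. complex_of_real (?G vs))"
    by (intro alternating_form_of_real alternating_form_wedge \<omega>)
  have eq: "?F vs = complex_of_real (k * ?G vs)" for vs
  proof (cases "length vs = 6")
    case True
    define H where "H = (\<lambda>vs. 1 * ?F vs + (- complex_of_real k) * complex_of_real (?G vs))"
    have "alternating_form H"
      unfolding H_def by (rule alternating_form_linear_combination[OF F_alt G_alt])
    moreover have "H ?bs = 0"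
      unfolding H_def F G by (simp add: k_def)
    ultimately have "H vs = 0"
      using top_form_eq_0[of H ?bs vs] span True by simp
    then show ?thesis by (simp add: H_def)
  next
    case False
    then show ?thesis
      using has_degree_wedge[OF deg deg'] has_degree_wedge[OF \<omega>(2) deg4] by (simp add: has_degree_def)
  qed
  have "norm_wrt \<Psi> ?\<omega> = sqrt k"
    unfolding norm_wrt_def
  proof (rule the_equality)
    show "0 \<le> sqrt k \<and> (\<forall>vs. ?F vs = complex_of_real ((sqrt k)\<^sup>2 * ?G vs))"
      using eq \<open>k > 0\<close> by simp
    fix c assume c: "0 \<le> c \<and> (\<forall>vs. ?F vs = complex_of_real (c\<^sup>2 * ?G vs))"
    then have "complex_of_real (c\<^sup>2 * ?G ?bs) = complex_of_real (k * ?G ?bs)"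
      using eq[of ?bs] by metis
    then have "c\<^sup>2 = k" unfolding G of_real_eq_iff by simp
    then show "c = sqrt k" using c by auto
  qed
  then show ?thesis using \<open>k > 0\<close> by simp
qed

section \<open>The anomaly flow\<close>

text \<open>All brackets lie in \<open>\<hh>\<close> and are determined by the map
  \<open>br e\<close> on \<open>\<hh>\<close>. A double bracket is a combination of vectors
  \<open>br e (br e v)\<close>, whose coefficients cancel in the cyclic sum.\<close>

lemma almost_abelian_lie_algebra:
  fixes br :: "'e::euclidean_space \<Rightarrow> 'e \<Rightarrow> 'e"
  assumes br: "bilinear br" "\<And>x. br x x = 0" and aa: "almost_abelian br"
  shows "lie_algebra br"
proof
  fix x y z
  note br_simps = bilinear_ladd[OF br(1)] bilinear_radd[OF br(1)] bilinear_lmul[OF br(1)]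
    bilinear_rmul[OF br(1)] bilinear_lsub[OF br(1)] bilinear_rsub[OF br(1)]
  have swap: "br x y = - br y x" for x y by (rule bilinear_alternating_swap[OF br])
  obtain \<hh> where \<hh>: "subspace \<hh>" "dim \<hh> + 1 = DIM('e)"
    and ideal: "\<And>x y. y \<in> \<hh> \<Longrightarrow> br x y \<in> \<hh>" and abel: "\<And>x y. x \<in> \<hh> \<Longrightarrow> y \<in> \<hh> \<Longrightarrow> br x y = 0"
    using aa unfolding almost_abelian_def by blast
  have span\<hh>: "span \<hh> = \<hh>" using \<hh>(1) by (rule span_eq_iff[THEN iffD2])
  have "\<hh> \<noteq> UNIV" using \<hh>(2) by auto
  then obtain e where e: "e \<notin> \<hh>" by blast
  have "dim (insert e \<hh>) = DIM('e)"
    using \<hh>(2) e by (simp add: dim_insert span\<hh>)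
  then have "span (insert e \<hh>) = UNIV" by (simp add: dim_eq_full)
  then have "\<exists>k. v - k *\<^sub>R e \<in> \<hh>" for v
    using span_breakdown_eq[of v e \<hh>] span\<hh> by auto
  then have dec: "\<exists>k a. a \<in> \<hh> \<and> v = a + k *\<^sub>R e" for v
    by (metis diff_add_cancel)
  obtain k a where x: "a \<in> \<hh>" "x = a + k *\<^sub>R e" using dec by blast
  obtain l b where y: "b \<in> \<hh>" "y = b + l *\<^sub>R e" using dec by blast
  obtain m c where z: "c \<in> \<hh>" "z = c + m *\<^sub>R e" using dec by blast
  have 1: "br (u + r *\<^sub>R e) (v + s *\<^sub>R e) = r *\<^sub>R br e v - s *\<^sub>R br e u"
    if "u \<in> \<hh>" "v \<in> \<hh>" for u v r s
    using that by (simp add: br_simps abel br(2) swap[of _ e])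
  have 2: "br (r *\<^sub>R br e v - s *\<^sub>R br e u) (w + q *\<^sub>R e) = - q *\<^sub>R (r *\<^sub>R br e (br e v) - s *\<^sub>R br e (br e u))"
    if "u \<in> \<hh>" "v \<in> \<hh>" "w \<in> \<hh>" for u v w r s q
    using that by (simp add: br_simps abel ideal swap[of _ e] algebra_simps)
  show "br (br x y) z + br (br y z) x + br (br z x) y = 0"
    unfolding x(2) y(2) z(2) using x(1) y(1) z(1)
    by (simp add: 1 2 algebra_simps)
qed (use br in auto)

text \<open>For fixed arguments d is a finite linear combination of values of the form, so pointwise
  differentiability in time suffices.\<close>

lemma has_vector_derivative_ext_d:
  fixes \<alpha> :: "real \<Rightarrow> ('e, complex) form"
  assumes "\<And>ws. ((\<lambda>s. \<alpha> s ws) has_vector_derivative \<alpha>' ws) F"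
  shows "((\<lambda>s. ext_d br (\<alpha> s) vs) has_vector_derivative ext_d br \<alpha>' vs) F"
  unfolding ext_d_def
  by (intro has_vector_derivative_sum has_vector_derivative_mult_right assms)

lemma anomaly_flow_balanced:
  fixes br :: "'e::euclidean_space \<Rightarrow> 'e \<Rightarrow> 'e"
  assumes dim: "DIM('e) = 6" and "lie_algebra br" and cs: "complex_structure br J"
    and \<Psi>: "is_type_form J 3 0 \<Psi>" "\<exists>vs. \<Psi> vs \<noteq> 0"
    and bal: "balanced br J g\<^sub>0" and flow: "anomaly_flow_solution br J \<Psi> \<tau> \<alpha>' g\<^sub>0 I g"
    and t: "t \<in> I"
  shows "balanced br J (g t)"
  unfolding balanced_def
proof
  fix vs
  interpret lie_algebra br by fact
  have J: "linear J" "\<And>x. J (J x) = - x" using cs by (auto simp: complex_structure_def)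
  define \<omega> where "\<omega> s = fundamental_form J (g s)" for s
  define \<eta> where "\<eta> s e ws = \<i> * del br J 1 2 (delbar br J 1 1 (\<lambda>xs. complex_of_real (\<omega> s xs))) ws
      - complex_of_real (\<alpha>' / 4 * trace_curvature_sq br (g s) (gauduchon br J (g s) \<tau>) e ws)" for s e ws
  define \<Phi> where "\<Phi> s = ext_d br (\<lambda>ws. complex_of_real (norm_wrt \<Psi> (\<omega> s) * (\<omega> s \<and>\<^sub>w \<omega> s) ws)) vs" for s
  have I: "is_interval I" "0 \<in> I" and g0: "g 0 = g\<^sub>0"
    using flow by (auto simp: anomaly_flow_solution_def)
  have herm: "hermitian_metric J (g s)" if "s \<in> I" for s
    using flow that by (auto simp: anomaly_flow_solution_def Let_def)
  have \<Phi>_eq: "\<Phi> s = complex_of_real (norm_wrt \<Psi> (\<omega> s) * ext_d br (\<omega> s \<and>\<^sub>w \<omega> s) vs)" for s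
    by (simp only: \<Phi>_def ext_d_of_real ext_d_mult)
  have "(\<Phi> has_vector_derivative 0) (at s within I)" if s: "s \<in> I" for s
  proof -
    obtain e where e: "orthonormal_frame (g s) e"
      and der: "\<And>ws. ((\<lambda>r. complex_of_real (norm_wrt \<Psi> (\<omega> r) * (\<omega> r \<and>\<^sub>w \<omega> r) ws))
        has_vector_derivative \<eta> s e ws) (at s within I)"
      using flow s unfolding anomaly_flow_solution_def Let_def \<eta>_def \<omega>_def by blast
    note h = herm[OF s]
    have g: "riemannian_metric (g s)" and inv: "g s (J x) (J y) = g s x y" for x y
      using h by (auto simp: hermitian_metric_def)
    note \<omega>' = fundamental_form_alternating[OF h J, folded \<omega>_def]
    have \<omega>_J: "\<omega> s [J x, J y] = \<omega> s [x, y]" for x y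
      by (simp add: \<omega>_def fundamental_form_def inv)
    have 1: "ext_d br (del br J 1 2 (delbar br J 1 1 (\<lambda>xs. complex_of_real (\<omega> s xs)))) vs = 0"
      by (rule ext_d_del_delbar[OF cs alternating_form_of_real[OF \<omega>'(1)]])
        (use \<omega>'(2) \<omega>_J in \<open>auto simp: has_degree_def\<close>)
    have "ext_d br (trace_curvature_sq br (g s) (gauduchon br J (g s) \<tau>) e) vs = 0"
      by (rule ext_d_trace_curvature_sq[OF lie_algebra_axioms g e])
        (rule gauduchon_metric[OF bilinear br_self g J(1) \<omega>'[unfolded \<omega>_def]])+
    with 1 have "ext_d br (\<eta> s e) vs = 0"
      unfolding \<eta>_def ext_d_diff ext_d_mult ext_d_of_real by simp
    moreover have "(\<Phi> has_vector_derivative ext_d br (\<eta> s e) vs) (at s within I)"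
      unfolding \<Phi>_def by (rule has_vector_derivative_ext_d[OF der])
    ultimately show ?thesis by simp
  qed
  \<comment> \<open>Derivatives are taken within \<open>I\<close>, so convexity of the interval is
    enough, whether or not its endpoints belong to it.\<close>
  then obtain k where k: "\<And>s. s \<in> I \<Longrightarrow> \<Phi> s = k"
    using has_vector_derivative_zero_constant[of I \<Phi>] I(1) is_interval_convex by blast
  have "\<Phi> 0 = 0"
    using bal by (simp add: \<Phi>_eq \<omega>_def g0 balanced_def)
  then have "\<Phi> t = 0" using k[OF t] k[OF I(2)] by simp
  then have "norm_wrt \<Psi> (\<omega> t) * ext_d br (\<omega> t \<and>\<^sub>w \<omega> t) vs = 0"
    unfolding \<Phi>_eq by (simp only: of_real_eq_0_iff)
  moreover have "norm_wrt \<Psi> (\<omega> t) > 0"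
    unfolding \<omega>_def by (rule volume_form_norm[OF dim herm[OF t] J \<Psi>])
  ultimately show "ext_d br (fundamental_form J (g t) \<and>\<^sub>w fundamental_form J (g t)) vs = 0"
    by (simp add: \<omega>_def)
qed

theorem theorem6p4:
  fixes A :: "('g::{t2_space, second_countable_topology}, real^6) atlas"
    and mul :: "'g \<Rightarrow> 'g \<Rightarrow> 'g" and one :: 'g and ivs :: "'g \<Rightarrow> 'g"
    and U :: "'g set" and \<phi> :: "'g \<Rightarrow> real^6"
    and J :: "real^6 \<Rightarrow> real^6" and \<Psi> :: "(real^6, complex) form"
    and g\<^sub>0 :: "real^6 \<Rightarrow> real^6 \<Rightarrow> real"
    and \<tau> \<alpha>' :: real and I :: "real set" and g :: "real \<Rightarrow> real^6 \<Rightarrow> real^6 \<Rightarrow> real"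
  assumes "lie_group A mul one ivs"
    and "(U, \<phi>) \<in> A" and "one \<in> U"
    and "almost_abelian (lie_bracket mul one U \<phi>)"
    and "complex_structure (lie_bracket mul one U \<phi>) J"
    and "is_type_form J 3 0 \<Psi>"
    and "\<exists>vs. \<Psi> vs \<noteq> 0"
    and "\<forall>vs. ext_d (lie_bracket mul one U \<phi>) \<Psi> vs = 0"
    and "hermitian_metric J g\<^sub>0"
    and "balanced (lie_bracket mul one U \<phi>) J g\<^sub>0"
    and "anomaly_flow_solution (lie_bracket mul one U \<phi>) J \<Psi> \<tau> \<alpha>' g\<^sub>0 I g"
  shows "\<forall>t\<in>I. balanced (lie_bracket mul one U \<phi>) J (g t)"
proof -
  let ?br = "lie_bracket mul one U \<phi>"
  have "lie_algebra ?br"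
    by (rule almost_abelian_lie_algebra[OF bilinear_lie_bracket[OF assms(1-3)] lie_bracket_self assms(4)])
  then show ?thesis
    using anomaly_flow_balanced[OF _ _ assms(5-7,10,11)] by simp
qed

end
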